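(* Let $G=(V,E)$ be a finite connected loopless multigraph and $\alpha'>0$. The meromorphic continuation of $\mathcal I_G^{\mathrm{zono}}(\alpha')$ in the energies $(x_v)_{v\in V},(y_e)_{e\in E}$ can have poles only along the hyperplanes $$X_S=-\frac{2m}{\alpha'},\qquad m=0,1,2,\ldots,$$ where $S$ ranges over the nonempty vertex subsets $S\subseteq V$ with $G[S]$ connected.
   Context: Loopless means no self-loops; cycles and parallel edges are allowed. For $x_v,y_e>0$, $$\mathcal I_G^{\mathrm{zono}}(\alpha')=(\alpha')^{|V|}\int_{\mathbb R^{V}}\prod_{v\in V}\mathrm d\tau_v\prod_{v\in V}(2\cosh\tau_v)^{-\alpha' x_v}\prod_{e=uv\in E}(2\cosh(\tau_u-\tau_v))^{-\alpha' y_e},$$ and this function is continued meromorphically to complex $(x,y)$. For $S\subseteq V$, $X_S=\sum_{v\in S}x_v+\sum_{e\in\partial_G(S)}y_e$, where $\partial_G(S)$ is the set of edges with exactly one endpoint in $S$, and $G[S]$ is the induced subgraph. *)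

theory Defs
  imports "HOL-Analysis.Analysis" "Graph_Theory.Digraph_Component"
begin

text \<open>
  A multigraph is modelled by a \<^typ>\<open>('v, 'e) pre_digraph\<close>: every edge carries an arbitrary
  orientation (tail, head), which is immaterial since everything below is symmetric in the two
  endpoints. The constant \<^const>\<open>Digraph_Component.connected\<close> refers to the underlying
  undirected graph and includes nonemptiness of the vertex set. Parallel and antiparallel arcs
  are allowed.
\<close>

definition zono_integral ::
    "('v, 'e) pre_digraph \<Rightarrow> real \<Rightarrow> ('v \<Rightarrow> real) \<Rightarrow> ('e \<Rightarrow> real) \<Rightarrow> real" where
  "zono_integral G a x y =
     a ^ card (verts G) *
     (LINT \<tau>|(\<Pi>\<^sub>M v\<in>verts G. lborel).
        (\<Prod>v\<in>verts G. (2 * cosh (\<tau> v)) powr (- a * x v)) *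
        (\<Prod>e\<in>arcs G. (2 * cosh (\<tau> (tail G e) - \<tau> (head G e))) powr (- a * y e)))"

definition edge_boundary :: "('v, 'e) pre_digraph \<Rightarrow> 'v set \<Rightarrow> 'e set" where
  "edge_boundary G S = {e \<in> arcs G. (tail G e \<in> S) \<noteq> (head G e \<in> S)}"

definition energy_sum ::
    "('v, 'e) pre_digraph \<Rightarrow> ('v \<Rightarrow> complex) \<Rightarrow> ('e \<Rightarrow> complex) \<Rightarrow> 'v set \<Rightarrow> complex" where
  "energy_sum G x y S = (\<Sum>v\<in>S. x v) + (\<Sum>e\<in>edge_boundary G S. y e)"

text \<open>
  Functions of several complex variables. Holomorphy on an open set is complex Frechet
  differentiability at every point; a meromorphic function is locally a quotient of holomorphic
  functions. Since HOL functions are total, the values on the zero set of the local denominators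
  are unconstrained.
\<close>

definition holomorphic_Cn :: "(complex ^ 'n \<Rightarrow> complex) \<Rightarrow> (complex ^ 'n) set \<Rightarrow> bool" where
  "holomorphic_Cn f U \<longleftrightarrow> open U \<and>
     (\<forall>z\<in>U. \<exists>D. (f has_derivative D) (at z) \<and> (\<forall>c w. D (c *s w) = c * D w))"

definition meromorphic_Cn :: "(complex ^ 'n \<Rightarrow> complex) \<Rightarrow> bool" where
  "meromorphic_Cn F \<longleftrightarrow>
     (\<forall>p. \<exists>r>0. \<exists>g h. holomorphic_Cn g (ball p r) \<and> holomorphic_Cn h (ball p r) \<and>
        (\<exists>z\<in>ball p r. h z \<noteq> 0) \<and> (\<forall>z\<in>ball p r. h z \<noteq> 0 \<longrightarrow> F z = g z / h z))"

text \<open>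
  The points with no neighbourhood to which the function extends holomorphically. Agreement is
  required only on a dense open subset, so that the unconstrained values play no role.
\<close>

definition polar_set :: "(complex ^ 'n \<Rightarrow> complex) \<Rightarrow> (complex ^ 'n) set" where
  "polar_set F = {p. \<not> (\<exists>U g. p \<in> U \<and> holomorphic_Cn g U \<and>
                       U \<subseteq> closure (interior {z \<in> U. F z = g z}))}"

text \<open>
  The energies are the coordinates of a single vector in a space whose coordinates are labelled
  bijectively by the disjoint union of vertices and edges, so that the edge set may be empty.
  The agreement with the integral is required at all real points with positive coordinates.
\<close>

definition zono_continuation ::
    "('v, 'e) pre_digraph \<Rightarrow> real \<Rightarrow> ('v + 'e \<Rightarrow> 'n::finite) \<Rightarrow> (complex ^ 'n \<Rightarrow> complex) \<Rightarrow> bool"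
  where
  "zono_continuation G a coord F \<longleftrightarrow> meromorphic_Cn F \<and>
     (\<forall>w :: real ^ 'n. (\<forall>k. w $ k > 0) \<longrightarrow>
        F (\<chi> k. complex_of_real (w $ k)) =
        complex_of_real
          (zono_integral G a (\<lambda>v. w $ coord (Inl v)) (\<lambda>e. w $ coord (Inr e))))"

end

theory Submission
  imports Defs "HOL-Complex_Analysis.Conformal_Mappings"
begin

text \<open>
  Give the two orientations of every edge independent exponents \<open>p\<close>, splitting
  \<open>(2 cosh t)\<^sup>2 = (1 + exp (2 t)) (1 + exp (- 2 t))\<close>. At infinity the logarithm of the integrand is
  piecewise linear in the direction, and cutting a potential into its level sets writes its decay
  rate as a nonnegative combination of the rates \<open>P\<^sub>S(p)\<close> of the directions
  \<open>\<plusminus>1\<^sub>S\<close>, \<open>G[S]\<close> connected. So the integral \<open>J\<close> converges and is holomorphic where all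
  \<open>Re P\<^sub>S > 0\<close>. Integration by parts along \<open>\<plusminus>1\<^sub>S\<close> expresses \<open>P\<^sub>S(p) J(p)\<close> as a combination of
  integrals \<open>J(p + e\<^sub>a)\<close> with \<open>P\<^sub>S\<close> raised by one and no other rate lowered. Hence
  \<open>J(p) \<Prod> 1/\<Gamma>(P\<^sub>S(p))\<close> satisfies a recursion with polynomial coefficients, which extends it to an
  entire function. Restricted to the energies \<open>P\<^sub>S = \<alpha> X\<^sub>S / 2\<close>, so the poles of the Gamma
  factors are the asserted hyperplanes; the identity theorem transfers this to every continuation.
\<close>

section \<open>Holomorphic functions of several variables\<close>

text \<open>The obstacle is that differentiating \<open>(2 * cosh t) powr (- a * y)\<close> produces
  \<open>tanh\<close>, which is not a shift of \<open>y\<close>. With one exponent per orientation,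
  the derivative of a \<open>softplus\<close> factor is a multiple of \<open>logistic\<close>, and
  multiplying the integrand by \<open>logistic\<close> is the same as raising one exponent by one.
  Along a potential \<theta> the identity \<open>logistic (- t) = 1 - logistic t\<close> can be used
  selectively, so that only arcs of positive \<theta>-tension are ever shifted. This is why the rate
  of the chosen direction goes up, and why the leftover constants sum to that rate itself.

  The price is that the directions \<open>1_S\<close> and \<open>- 1_S\<close> have different rates
  for general exponents, so each gets its own Gamma factor. The two rates coincide on the energies;
  the denominator then vanishes to a higher order than one factor would, which is harmless because
  only its zero set is used.

  The values of a given continuation are arbitrary on the zero sets of its local denominators. It is
  therefore compared with the constructed quotient through cross-multiplied identities between
  holomorphic functions, never pointwise.\<close>

definition cdiff :: "(complex ^ 'n \<Rightarrow> complex) \<Rightarrow> complex ^ 'n \<Rightarrow> bool" where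
  "cdiff f z \<longleftrightarrow> (\<exists>D. (f has_derivative D) (at z) \<and> (\<forall>c w. D (c *s w) = c * D w))"

lemma holomorphic_Cn_cdiff: "holomorphic_Cn f U \<longleftrightarrow> open U \<and> (\<forall>z\<in>U. cdiff f z)"
  by (simp add: holomorphic_Cn_def cdiff_def)

lemma cdiffI: "(f has_derivative D) (at z) \<Longrightarrow> (\<And>c w. D (c *s w) = c * D w) \<Longrightarrow> cdiff f z"
  unfolding cdiff_def by blast

lemma cdiff_const [simp]: "cdiff (\<lambda>z. c) z"
  by (rule cdiffI[where D = "\<lambda>_. 0"]) auto

lemma cdiff_nth [simp]: "cdiff (\<lambda>z. z $ i) z"
  by (rule cdiffI[OF bounded_linear_imp_has_derivative[OF bounded_linear_vec_nth]]) simp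

lemma
  assumes "cdiff f z" "cdiff g z"
  shows cdiff_add: "cdiff (\<lambda>z. f z + g z) z"
    and cdiff_diff: "cdiff (\<lambda>z. f z - g z) z"
    and cdiff_mult: "cdiff (\<lambda>z. f z * g z) z"
proof -
  obtain D E where *: "(f has_derivative D) (at z)" "\<And>c w. D (c *s w) = c * D w"
    "(g has_derivative E) (at z)" "\<And>c w. E (c *s w) = c * E w"
    using assms unfolding cdiff_def by auto
  show "cdiff (\<lambda>z. f z + g z) z"
    by (rule cdiffI[OF has_derivative_add[OF *(1,3)]]) (simp add: * algebra_simps)
  show "cdiff (\<lambda>z. f z - g z) z"
    by (rule cdiffI[OF has_derivative_diff[OF *(1,3)]]) (simp add: * algebra_simps)
  show "cdiff (\<lambda>z. f z * g z) z"
    by (rule cdiffI[OF has_derivative_mult[OF *(1,3)]]) (simp add: * algebra_simps)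
qed

lemma cdiff_sum: "(\<And>i. i \<in> I \<Longrightarrow> cdiff (f i) z) \<Longrightarrow> cdiff (\<lambda>z. \<Sum>i\<in>I. f i z) z"
  by (induction I rule: infinite_finite_induct) (auto intro!: cdiff_add)

lemma cdiff_prod: "(\<And>i. i \<in> I \<Longrightarrow> cdiff (f i) z) \<Longrightarrow> cdiff (\<lambda>z. \<Prod>i\<in>I. f i z) z"
  by (induction I rule: infinite_finite_induct) (auto intro!: cdiff_mult)

lemma cdiff_compose_field:
  assumes "f field_differentiable (at (g z))" "cdiff g z"
  shows "cdiff (\<lambda>z. f (g z)) z"
proof -
  obtain D where D: "(g has_derivative D) (at z)" "\<And>c w. D (c *s w) = c * D w"
    using assms(2) unfolding cdiff_def by blast
  obtain f' where "(f has_field_derivative f') (at (g z))"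
    using assms(1) unfolding field_differentiable_def by blast
  then have "(f has_derivative (*) f') (at (g z))"
    by (simp add: has_field_derivative_def)
  from has_derivative_compose[OF D(1) this] show ?thesis
    by (rule cdiffI) (simp add: D(2) mult_ac)
qed

lemma cdiff_divide:
  assumes "cdiff f z" "cdiff g z" "g z \<noteq> 0"
  shows "cdiff (\<lambda>z. f z / g z) z"
proof -
  have "inverse field_differentiable (at (g z))"
    using assms(3) by (intro field_differentiable_inverse field_differentiable_ident)
  then have "cdiff (\<lambda>z. inverse (g z)) z" by (rule cdiff_compose_field) fact
  from cdiff_mult[OF assms(1) this] show ?thesis by (simp add: divide_inverse)
qed

lemma cdiff_compose_affine:
  fixes A :: "complex ^ 'm \<Rightarrow> complex ^ 'n"
  assumes "cdiff f (A z)" "(A has_derivative A') (at z)" "\<And>c w. A' (c *s w) = c *s A' w"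
  shows "cdiff (\<lambda>z. f (A z)) z"
proof -
  obtain D where D: "(f has_derivative D) (at (A z))" "\<And>c w. D (c *s w) = c * D w"
    using assms(1) unfolding cdiff_def by blast
  from has_derivative_compose[OF assms(2) D(1)] show ?thesis
    by (rule cdiffI) (simp add: D(2) assms(3))
qed

lemma cdiff_shift: "cdiff f (z + c) \<Longrightarrow> cdiff (\<lambda>z. f (z + c)) z"
  by (rule cdiff_compose_affine[where A' = "\<lambda>w. w"]) (auto intro!: derivative_eq_intros)

lemma cdiff_transform:
  assumes "cdiff f z" "open U" "z \<in> U" "\<And>w. w \<in> U \<Longrightarrow> f w = g w"
  shows "cdiff g z"
  using assms has_derivative_transform_within_open unfolding cdiff_def by metis

lemma cdiff_isCont: "cdiff f z \<Longrightarrow> isCont f z"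
  unfolding cdiff_def using has_derivative_continuous by blast

lemma open_nonzero:
  assumes "open U" "\<And>z. z \<in> U \<Longrightarrow> cdiff h z"
  shows "open {z \<in> U. h z \<noteq> 0}"
proof -
  have "continuous_on U h"
    using assms(2) cdiff_isCont continuous_at_imp_continuous_on by blast
  then have "open (U \<inter> h -` (- {0}))"
    using assms(1) by (intro continuous_open_preimage) auto
  moreover have "U \<inter> h -` (- {0}) = {z \<in> U. h z \<noteq> 0}" by auto
  ultimately show ?thesis by simp
qed

section \<open>Restriction to complex lines and identity theorems\<close>

lemma has_derivative_complex_line:
  "((\<lambda>t. q + t *s v) has_derivative (\<lambda>t. t *s v)) (at (t :: complex))"
proof -
  have "bounded_linear (\<lambda>t :: complex. t *s v)"
    by (rule linear_conv_bounded_linear[THEN iffD1])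
       (auto intro!: linearI simp: vec_eq_iff algebra_simps)
  then have "((\<lambda>t. t *s v) has_derivative (\<lambda>t. t *s v)) (at t)"
    by (rule bounded_linear_imp_has_derivative)
  then show ?thesis by (auto intro!: derivative_eq_intros)
qed

lemma continuous_complex_line: "continuous_on S (\<lambda>t :: complex. q + t *s v)"
  by (intro continuous_at_imp_continuous_on ballI
      has_derivative_continuous[OF has_derivative_complex_line])

lemma cdiff_line:
  assumes "cdiff f (q + t *s v)"
  shows "(\<lambda>t. f (q + t *s v)) field_differentiable (at t)"
proof -
  obtain D where D: "(f has_derivative D) (at (q + t *s v))" "\<And>c w. D (c *s w) = c * D w"
    using assms(1) unfolding cdiff_def by blast
  have "((\<lambda>t. f (q + t *s v)) has_derivative (\<lambda>t. D (t *s v))) (at t)"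
    by (rule has_derivative_compose[OF has_derivative_complex_line D(1)])
  then have "((\<lambda>t. f (q + t *s v)) has_field_derivative D v) (at t)"
    unfolding has_field_derivative_def by (simp add: D(2) mult_commute_abs)
  then show ?thesis unfolding field_differentiable_def by blast
qed

lemma
  assumes "open U" "convex U"
  shows open_line_section: "open {t :: complex. q + t *s v \<in> U}"
    and convex_line_section: "convex {t :: complex. q + t *s v \<in> U}"
proof -
  from open_vimage[OF assms(1) continuous_complex_line] show "open {t :: complex. q + t *s v \<in> U}"
    by (simp add: vimage_def)
  show "convex {t :: complex. q + t *s v \<in> U}"
  proof (rule convexI)
    fix x y :: complex and a b :: real
    assume *: "x \<in> {t. q + t *s v \<in> U}" "y \<in> {t. q + t *s v \<in> U}" "0 \<le> a" "0 \<le> b" "a + b = 1"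
    have "q + (a *\<^sub>R x + b *\<^sub>R y) *s v = (a + b) *\<^sub>R q + (a *\<^sub>R x + b *\<^sub>R y) *s v"
      using * by simp
    also have "\<dots> = a *\<^sub>R (q + x *s v) + b *\<^sub>R (q + y *s v)"
      by (simp add: vec_eq_iff algebra_simps)
    also have "\<dots> \<in> U" using * assms(2) by (intro convexD) auto
    finally show "a *\<^sub>R x + b *\<^sub>R y \<in> {t. q + t *s v \<in> U}" by simp
  qed
qed

text \<open>The parameters for which a complex line stays in a convex open set form a convex, hence
  connected, open subset of the plane, so the one-variable identity theorem applies on it.\<close>

lemma line_section_vanish:
  assumes U: "open U" "convex U" and f: "\<And>z. z \<in> U \<Longrightarrow> cdiff f z"
    and s: "q + s *s v \<in> U"
    and X: "\<And>t. t \<in> X \<Longrightarrow> q + t *s v \<in> U \<and> f (q + t *s v) = 0" "t0 \<in> X" "t0 islimpt X"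
  shows "f (q + s *s v) = 0"
proof -
  let ?T = "{t :: complex. q + t *s v \<in> U}"
  have "(\<lambda>t. f (q + t *s v)) holomorphic_on ?T"
    unfolding holomorphic_on_def
    using f cdiff_line field_differentiable_at_within by blast
  from analytic_continuation[OF this open_line_section[OF U]
      convex_connected[OF convex_line_section[OF U]], of X t0 s] show ?thesis
    using X s by auto
qed

text \<open>The complex line through \<open>q\<close> and \<open>z\<close> meets \<open>W\<close> in
  an open set of parameters around 0, and \<open>z\<close> sits at parameter 1. Convexity of
  \<open>U\<close> is what lets a single line do.\<close>

lemma identity_Cn:
  assumes U: "open U" "convex U" and f: "\<And>z. z \<in> U \<Longrightarrow> cdiff f z"
    and W: "open W" "q \<in> W" "W \<subseteq> U" "\<And>z. z \<in> W \<Longrightarrow> f z = 0" and z: "z \<in> U"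
  shows "f z = 0"
proof -
  let ?X = "{t :: complex. q + t *s (z - q) \<in> W}"
  have "open ?X"
    using open_vimage[OF W(1) continuous_complex_line, of q "z - q"] unfolding vimage_def .
  moreover have "0 \<in> ?X" using W by simp
  ultimately have "0 islimpt ?X"
    using interior_limit_point interior_open by blast
  then have "f (q + 1 *s (z - q)) = 0"
    using W z \<open>0 \<in> ?X\<close> by (intro line_section_vanish[OF U f, where X = ?X and ?t0.0 = 0]) auto
  then show ?thesis by simp
qed

text \<open>Absence of zero divisors: if the product vanished on \<open>U\<close>, then
  \<open>g\<close> would vanish on the nonempty open set where \<open>f\<close> does not, hence
  everywhere.\<close>

lemma nonzero_product_Cn:
  assumes U: "open U" "convex U" and f: "\<And>z. z \<in> U \<Longrightarrow> cdiff f z"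
    and g: "\<And>z. z \<in> U \<Longrightarrow> cdiff g z"
    and ne: "\<exists>z\<in>U. f z \<noteq> 0" "\<exists>z\<in>U. g z \<noteq> 0"
  shows "\<exists>z\<in>U. f z * g z \<noteq> 0"
proof (rule ccontr)
  assume *: "\<not> ?thesis"
  obtain q where q: "q \<in> U" "f q \<noteq> 0" using ne by blast
  have "g z = 0" if "z \<in> U" for z
    by (rule identity_Cn[OF U g open_nonzero[OF U(1) f], where q = q]) (use q * that in auto)
  then show False using ne by blast
qed

definition cvec :: "real ^ 'n \<Rightarrow> complex ^ 'n" where
  "cvec w = (\<chi> k. complex_of_real (w $ k))"

lemma cvec_nth [simp]: "cvec w $ k = complex_of_real (w $ k)"
  by (simp add: cvec_def)

lemma dist_cvec [simp]: "dist (cvec a) (cvec b) = dist a b"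
  by (simp add: dist_vec_def)

text \<open>Write \<open>z\<close> as \<open>u + \<i> * w\<close> with real \<open>u\<close> and
  \<open>w\<close>. The complex line through \<open>u\<close> in direction \<open>w\<close> has real
  points at real parameters and reaches \<open>z\<close> at \<i>. Taking real parts does not
  increase the distance to the real centre, so \<open>u\<close> and the nearby real points lie in
  the ball, and their parameters accumulate at 0.\<close>

lemma identity_Cn_real:
  fixes p :: "real ^ 'n" and f :: "complex ^ 'n \<Rightarrow> complex"
  assumes f: "\<And>z. z \<in> ball (cvec p) r \<Longrightarrow> cdiff f z"
    and zero: "\<And>w. w \<in> ball p r \<Longrightarrow> f (cvec w) = 0"
    and z: "z \<in> ball (cvec p) r"
  shows "f z = 0"
proof -
  define u :: "real ^ 'n" where "u = (\<chi> k. Re (z $ k))"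
  define w :: "real ^ 'n" where "w = (\<chi> k. Im (z $ k))"
  have z_eq: "z = cvec u + \<i> *s cvec w"
    by (simp add: vec_eq_iff u_def w_def complex_eq_iff)
  have line: "cvec u + complex_of_real t *s cvec w = cvec (u + t *\<^sub>R w)" for t
    by (simp add: vec_eq_iff)
  have "norm (p - u) \<le> norm (cvec p - z)"
  proof (subst (1 2) norm_vec_def, rule L2_set_mono)
    fix k
    show "norm ((p - u) $ k) \<le> norm ((cvec p - z) $ k)"
      using abs_Re_le_cmod[of "(cvec p - z) $ k"] by (simp add: u_def)
  qed auto
  then have u: "u \<in> ball p r" using z by (simp add: dist_norm)
  let ?Y = "{t :: real. u + t *\<^sub>R w \<in> ball p r}"
  let ?X = "complex_of_real ` ?Y"
  have "open ?Y"
    using open_vimage[OF open_ball, of "\<lambda>t. u + t *\<^sub>R w" p r]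
    by (simp add: vimage_def continuous_intros del: mem_ball)
  moreover have "0 \<in> ?Y" using u by simp
  ultimately obtain e where e: "e > 0" "ball 0 e \<subseteq> ?Y"
    by (rule openE)
  have "(0::complex) islimpt ?X"
    unfolding islimpt_approachable
  proof (intro allI impI)
    fix d :: real assume "d > 0"
    let ?t = "min (e/2) (d/2)"
    have "?t \<in> ?Y" using e(1) \<open>d > 0\<close> by (intro subsetD[OF e(2)]) auto
    moreover have "?t > 0" "?t < d" using e(1) \<open>d > 0\<close> by auto
    ultimately show "\<exists>x'\<in>?X. x' \<noteq> 0 \<and> dist x' 0 < d"
      by (intro bexI[of _ "complex_of_real ?t"]) auto
  qed
  moreover have "0 \<in> ?X" using \<open>0 \<in> ?Y\<close> by force
  moreover have "cvec u + t *s cvec w \<in> ball (cvec p) r \<and> f (cvec u + t *s cvec w) = 0" if "t \<in> ?X" for t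
    using that zero by (auto simp: line)
  ultimately have "f (cvec u + \<i> *s cvec w) = 0"
    using z by (intro line_section_vanish[OF open_ball convex_ball f, where X = ?X and ?t0.0 = 0])
      (auto simp: z_eq)
  then show ?thesis by (simp add: z_eq)
qed

section \<open>Singularities of a continuation with known denominator\<close>

definition local_quotient ::
    "(complex ^ 'n \<Rightarrow> complex) \<Rightarrow> complex ^ 'n \<Rightarrow> real \<Rightarrow> (complex ^ 'n \<Rightarrow> complex) \<Rightarrow>
      (complex ^ 'n \<Rightarrow> complex) \<Rightarrow> bool" where
  "local_quotient F p r g h \<longleftrightarrow> r > 0 \<and> (\<forall>z\<in>ball p r. cdiff g z \<and> cdiff h z) \<and>
    (\<exists>z\<in>ball p r. h z \<noteq> 0) \<and> (\<forall>z\<in>ball p r. h z \<noteq> 0 \<longrightarrow> F z = g z / h z)"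

lemma meromorphic_Cn_local_quotient:
  assumes "meromorphic_Cn F" obtains r g h where "local_quotient F p r g h"
proof -
  obtain r g h where "r > 0" "holomorphic_Cn g (ball p r)" "holomorphic_Cn h (ball p r)"
    "\<exists>z\<in>ball p r. h z \<noteq> 0" "\<forall>z\<in>ball p r. h z \<noteq> 0 \<longrightarrow> F z = g z / h z"
    using assms unfolding meromorphic_Cn_def by blast
  then have "local_quotient F p r g h"
    unfolding local_quotient_def holomorphic_Cn_cdiff by blast
  then show ?thesis by (rule that)
qed

lemma local_quotient_nonzero:
  assumes "local_quotient F p r g h" "open W" "W \<noteq> {}" "W \<subseteq> ball p r"
  shows "\<exists>z\<in>W. h z \<noteq> 0"
proof (rule ccontr)
  assume *: "\<not> ?thesis"
  obtain q where q: "q \<in> W" using assms(3) by blast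
  have "h z = 0" if "z \<in> ball p r" for z
    by (rule identity_Cn[OF open_ball convex_ball _ assms(2) q assms(4) _ that])
      (use * assms(1) in \<open>auto simp: local_quotient_def\<close>)
  then show False using assms(1) by (auto simp: local_quotient_def)
qed

text \<open>Both sides of the cross-multiplied identity are holomorphic on the whole ball, whereas
  the quotients are meaningful only off the zeros of \<open>h\<close> and \<open>H\<close>. This is
  the form in which the identity theorem can be applied.\<close>

lemma cross_multiplied_on_ball:
  assumes rep: "local_quotient F p r g h" and \<Phi>: "\<And>z. cdiff \<Phi> z" and H: "\<And>z. cdiff H z"
    and W: "open W" "W \<noteq> {}" "W \<subseteq> ball p r"
    and eq: "\<And>z. z \<in> W \<Longrightarrow> g z * H z = \<Phi> z * h z" and z: "z \<in> ball p r"
  shows "g z * H z = \<Phi> z * h z"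
proof -
  obtain q where q: "q \<in> W" using W by blast
  have "g z * H z - \<Phi> z * h z = 0"
    by (rule identity_Cn[OF open_ball convex_ball _ W(1) q W(3) _ z])
      (use rep eq in \<open>auto simp: local_quotient_def intro!: cdiff_diff cdiff_mult \<Phi> H\<close>)
  then show ?thesis by simp
qed

text \<open>Where neither denominator vanishes, both quotients equal \<open>F\<close>, so the
  identity passes from one pair to the other. That set is open and nonempty in the intersection of
  the balls, and the identity theorem spreads the result over the second ball.\<close>

lemma cross_multiplied_transfer:
  assumes rep: "local_quotient F p r g h" "local_quotient F p' r' g' h'"
    and \<Phi>: "\<And>z. cdiff \<Phi> z" and H: "\<And>z. cdiff H z"
    and eq: "\<And>z. z \<in> ball p r \<Longrightarrow> g z * H z = \<Phi> z * h z"
    and meet: "ball p r \<inter> ball p' r' \<noteq> {}" and z: "z \<in> ball p' r'"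
  shows "g' z * H z = \<Phi> z * h' z"
proof -
  let ?B = "ball p r \<inter> ball p' r'"
  have B: "open ?B" "convex ?B" by (auto intro: convex_Int)
  define W where "W = {z \<in> ?B. h z * h' z \<noteq> 0}"
  have cd: "cdiff h z" "cdiff h' z" if "z \<in> ?B" for z
    using rep that by (auto simp: local_quotient_def)
  have "\<exists>z\<in>?B. h z * h' z \<noteq> 0"
    by (rule nonzero_product_Cn[OF B cd local_quotient_nonzero[OF rep(1) B(1) meet]
          local_quotient_nonzero[OF rep(2) B(1) meet]]) auto
  then have "W \<noteq> {}" by (auto simp: W_def)
  moreover have "open W"
    unfolding W_def by (rule open_nonzero[OF B(1)]) (rule cdiff_mult[OF cd])
  moreover have "g' z * H z = \<Phi> z * h' z" if "z \<in> W" for z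
  proof -
    have nz: "h z \<noteq> 0" "h' z \<noteq> 0" and zB: "z \<in> ball p r" "z \<in> ball p' r'"
      using that by (auto simp: W_def)
    then have "g z / h z = g' z / h' z"
      using rep unfolding local_quotient_def by metis
    then have "g z * h' z = g' z * h z" using nz by (simp add: field_simps)
    then have "h z * (g' z * H z) = h z * (\<Phi> z * h' z)"
      using eq[OF zB(1)] by (metis mult.assoc mult.commute)
    then show ?thesis using nz by simp
  qed
  moreover have "W \<subseteq> ball p' r'" by (auto simp: W_def)
  ultimately show ?thesis using cross_multiplied_on_ball[OF rep(2) \<Phi> H] z by blast
qed

text \<open>Continuation along chains of balls, replaced by connectedness of the space: the set of
  centres with a good local quotient is open and closed by the transfer lemma, and it contains
  \<open>cvec 1\<close> by the agreement at positive real points.\<close>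

lemma cross_multiplied_everywhere:
  fixes F \<Phi> H :: "complex ^ 'n \<Rightarrow> complex"
  assumes F: "meromorphic_Cn F" and \<Phi>: "\<And>z. cdiff \<Phi> z" and H: "\<And>z. cdiff H z"
    and pos: "\<And>w :: real ^ 'n. (\<And>k. w $ k > 0) \<Longrightarrow>
      H (cvec w) \<noteq> 0 \<and> F (cvec w) = \<Phi> (cvec w) / H (cvec w)"
  shows "\<exists>r g h. local_quotient F p r g h \<and> (\<forall>z\<in>ball p r. g z * H z = \<Phi> z * h z)"
proof -
  define A where
    "A = {p. \<exists>r g h. local_quotient F p r g h \<and> (\<forall>z\<in>ball p r. g z * H z = \<Phi> z * h z)}"
  have in_A: "p' \<in> A"
    if "local_quotient F p r g h" "\<forall>z\<in>ball p r. g z * H z = \<Phi> z * h z"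
      "local_quotient F p' r' g' h'" "ball p r \<inter> ball p' r' \<noteq> {}" for p p' r g h r' g' h'
    using cross_multiplied_transfer[OF that(1,3) \<Phi> H] that unfolding A_def by blast
  have center: "p \<in> ball p r" if "local_quotient F p r g h" for p r g h
    using that by (simp add: local_quotient_def)
  have "open A"
    unfolding open_contains_ball
  proof
    fix p assume "p \<in> A"
    then obtain r g h where r: "local_quotient F p r g h" "\<forall>z\<in>ball p r. g z * H z = \<Phi> z * h z"
      unfolding A_def by blast
    have "ball p r \<subseteq> A"
    proof
      fix p' assume p': "p' \<in> ball p r"
      obtain r' g' h' where r': "local_quotient F p' r' g' h'"
        using meromorphic_Cn_local_quotient[OF F] by blast
      show "p' \<in> A" using in_A[OF r r'] center[OF r'] p' by blast
    qed
    then show "\<exists>e>0. ball p e \<subseteq> A" using r unfolding local_quotient_def by blast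
  qed
  moreover have "open (- A)"
    unfolding open_contains_ball
  proof
    fix p assume p: "p \<in> - A"
    obtain r g h where r: "local_quotient F p r g h"
      using meromorphic_Cn_local_quotient[OF F] by blast
    have "p' \<notin> A" if p': "p' \<in> ball p r" for p'
    proof
      assume "p' \<in> A"
      then obtain r' g' h' where r': "local_quotient F p' r' g' h'"
          "\<forall>z\<in>ball p' r'. g' z * H z = \<Phi> z * h' z"
        unfolding A_def by blast
      have "p \<in> A" using in_A[OF r' r] center[OF r'(1)] p' by blast
      then show False using p by blast
    qed
    then show "\<exists>e>0. ball p e \<subseteq> - A" using r unfolding local_quotient_def by blast
  qed
  moreover have "cvec 1 \<in> A"
  proof -
    obtain r g h where r: "local_quotient F (cvec 1) r g h"
      using meromorphic_Cn_local_quotient[OF F] by blast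
    \<comment> \<open>Radius at most 1 around the all-ones vector keeps all coordinates of the real
      points positive.\<close>
    define s where "s = min r 1"
    have s: "s > 0" "s \<le> r" "s \<le> 1" using r by (auto simp: s_def local_quotient_def)
    have sub: "ball (cvec 1) s \<subseteq> ball (cvec 1) r" using s by (intro subset_ball)
    \<comment> \<open>The extra factor \<open>h\<close> makes the expression vanish also at real
      points where \<open>h\<close> is zero, at which the local quotient says nothing about
      \<open>F\<close>. It is cancelled on \<open>W\<close> below.\<close>
    have cd: "cdiff (\<lambda>z. (g z * H z - \<Phi> z * h z) * h z) z" if "z \<in> ball (cvec 1) s" for z
      using subsetD[OF sub that] r unfolding local_quotient_def
      by (intro cdiff_mult cdiff_diff \<Phi> H) auto
    have zero: "(g (cvec w) * H (cvec w) - \<Phi> (cvec w) * h (cvec w)) * h (cvec w) = 0"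
      if w: "w \<in> ball 1 s" for w
    proof -
      have "w $ k > 0" for k
        using component_le_norm_cart[of "1 - w" k] w s by (auto simp: dist_norm)
      then have H0: "H (cvec w) \<noteq> 0" and Fw: "F (cvec w) = \<Phi> (cvec w) / H (cvec w)"
        using pos by blast+
      have "cvec w \<in> ball (cvec 1) r" using w s by auto
      then have "h (cvec w) \<noteq> 0 \<Longrightarrow> \<Phi> (cvec w) / H (cvec w) = g (cvec w) / h (cvec w)"
        using r Fw unfolding local_quotient_def by metis
      then show ?thesis
        using H0 by (cases "h (cvec w) = 0") (auto simp: field_simps)
    qed
    have vanish: "(g z * H z - \<Phi> z * h z) * h z = 0" if "z \<in> ball (cvec 1) s" for z
      using identity_Cn_real[OF cd zero that] .
    define W where "W = {z \<in> ball (cvec 1) s. h z \<noteq> 0}"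
    have cdh: "cdiff h z" if "z \<in> ball (cvec 1) s" for z
      using subsetD[OF sub that] r by (auto simp: local_quotient_def)
    have W: "open W" "W \<noteq> {}" "W \<subseteq> ball (cvec 1) r"
      using open_nonzero[OF open_ball cdh] local_quotient_nonzero[OF r open_ball _ sub] s sub
      unfolding W_def by auto
    have "g z * H z = \<Phi> z * h z" if "z \<in> ball (cvec 1) r" for z
      by (rule cross_multiplied_on_ball[OF r \<Phi> H W _ that]) (use vanish in \<open>auto simp: W_def\<close>)
    then show ?thesis using r unfolding A_def by blast
  qed
  ultimately have "A = UNIV"
    using connected_clopen[THEN iffD1, OF connected_UNIV, rule_format, of A]
    by (auto simp: closed_def)
  then show ?thesis unfolding A_def by blast
qed

text \<open>Near a point with \<open>H\<close> nonzero, \<Phi> divided by \<open>H\<close> is the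
  required extension. It can differ from \<open>F\<close> only where the local denominator
  \<open>h\<close> vanishes, and \<open>h\<close> cannot vanish on a nonempty open set, so the set
  of agreement has dense interior.\<close>

lemma polar_set_subset_zeros:
  fixes F \<Phi> H :: "complex ^ 'n \<Rightarrow> complex"
  assumes F: "meromorphic_Cn F" and \<Phi>: "\<And>z. cdiff \<Phi> z" and H: "\<And>z. cdiff H z"
    and pos: "\<And>w :: real ^ 'n. (\<And>k. w $ k > 0) \<Longrightarrow>
      H (cvec w) \<noteq> 0 \<and> F (cvec w) = \<Phi> (cvec w) / H (cvec w)"
  shows "polar_set F \<subseteq> {z. H z = 0}"
proof
  fix p assume p: "p \<in> polar_set F"
  show "p \<in> {z. H z = 0}"
  proof (rule ccontr)
    assume "p \<notin> {z. H z = 0}"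
    then have Hp: "H p \<noteq> 0" by simp
    obtain r g h where r: "local_quotient F p r g h" "\<forall>z\<in>ball p r. g z * H z = \<Phi> z * h z"
      using cross_multiplied_everywhere[OF assms] by blast
    define U where "U = {z \<in> ball p r. H z \<noteq> 0}"
    define f where "f = (\<lambda>z. \<Phi> z / H z)"
    have U: "open U" "U \<subseteq> ball p r" "p \<in> U"
      using Hp r open_nonzero[OF open_ball H, of p r] by (auto simp: U_def local_quotient_def)
    have "holomorphic_Cn f U"
      unfolding holomorphic_Cn_cdiff f_def using U(1)
      by (auto simp: U_def intro!: cdiff_divide \<Phi> H)
    moreover have "U \<subseteq> closure (interior {z \<in> U. F z = f z})"
    proof
      fix z assume z: "z \<in> U"
      define D where "D = {z \<in> U. h z \<noteq> 0}"
      have "cdiff h z" if "z \<in> U" for z using r U that by (auto simp: local_quotient_def)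
      then have "open D" unfolding D_def by (intro open_nonzero U(1))
      moreover have "F z = f z" if "z \<in> D" for z
      proof -
        have "z \<in> ball p r" "H z \<noteq> 0" "h z \<noteq> 0" using that by (auto simp: D_def U_def)
        moreover from this have "F z = g z / h z" "g z * H z = \<Phi> z * h z"
          using r unfolding local_quotient_def by blast+
        ultimately show ?thesis by (simp add: f_def frac_eq_eq)
      qed
      then have "D \<subseteq> {z \<in> U. F z = f z}" by (auto simp: D_def)
      ultimately have "D \<subseteq> interior {z \<in> U. F z = f z}" by (intro interior_maximal)
      moreover have "z \<in> closure D"
      proof (rule ccontr)
        assume "z \<notin> closure D"
        then have "U - closure D \<noteq> {}" using z by blast
        moreover have "open (U - closure D)" using U(1) by (intro open_Diff) auto
        ultimately obtain y where "y \<in> U - closure D" "h y \<noteq> 0"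
          using local_quotient_nonzero[OF r(1), of "U - closure D"] U(2) by blast
        then show False using closure_subset[of D] by (auto simp: D_def)
      qed
      ultimately show "z \<in> closure (interior {z \<in> U. F z = f z})"
        using closure_mono by blast
    qed
    ultimately have "p \<notin> polar_set F" using U(3) unfolding polar_set_def by blast
    then show False using p by simp
  qed
qed

section \<open>Integration over a finite power of the real line\<close>

definition coord_norm :: "'v set \<Rightarrow> ('v \<Rightarrow> real) \<Rightarrow> real" where
  "coord_norm V \<tau> = (\<Sum>v\<in>V. \<bar>\<tau> v\<bar>)"

lemma integrable_exp_abs:
  assumes "\<eta> > 0"
  shows "integrable lborel (\<lambda>t :: real. exp (- \<eta> * \<bar>t\<bar>))"
proof -
  have half: "set_integrable lborel {0..} (\<lambda>t :: real. exp (- \<eta> * t))"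
  proof -
    have "set_integrable lebesgue {0..} (\<lambda>t :: real. exp (- \<eta> * t))"
      by (intro nonnegative_absolutely_integrable_1 integrable_on_exp_minus_to_infinity assms) auto
    then show ?thesis
      unfolding set_integrable_def by (subst (asm) integrable_completion) auto
  qed
  then have 1: "integrable lborel (\<lambda>t. indicat_real {0..} t *\<^sub>R exp (- \<eta> * t))"
    by (simp add: set_integrable_def)
  have 2: "integrable lborel (\<lambda>t. indicat_real {0..} (- t) *\<^sub>R exp (- \<eta> * - t))"
    using lborel_integrable_real_affine[OF 1, of "-1" 0] by simp
  show ?thesis
  proof (rule Bochner_Integration.integrable_bound[OF Bochner_Integration.integrable_add[OF 1 2]])
    show "AE t in lborel. norm (exp (- \<eta> * \<bar>t\<bar>)) \<le> norm (indicat_real {0..} t *\<^sub>R exp (- \<eta> * t) +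
        indicat_real {0..} (- t) *\<^sub>R exp (- \<eta> * - t))"
      by (intro AE_I2) (auto simp: indicator_def abs_if)
  qed measurable
qed

lemma integrable_exp_coord_norm:
  assumes "finite V" "\<eta> > 0"
  shows "integrable (\<Pi>\<^sub>M v\<in>V. lborel) (\<lambda>\<tau>. exp (- \<eta> * coord_norm V \<tau>))"
proof -
  interpret product_sigma_finite "\<lambda>_ :: 'a. lborel :: real measure" ..
  have "integrable (\<Pi>\<^sub>M v\<in>V. lborel) (\<lambda>\<tau>. \<Prod>v\<in>V. exp (- \<eta> * \<bar>\<tau> v\<bar>))"
    by (rule product_integrable_prod[OF assms(1) integrable_exp_abs[OF assms(2)]])
  then show ?thesis
    by (simp add: coord_norm_def sum_distrib_left exp_sum[OF assms(1), symmetric] sum_negf)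
qed

lemma integrable_exp_coord_norm_bound:
  fixes f :: "('v \<Rightarrow> real) \<Rightarrow> complex"
  assumes "finite V" "\<eta> > 0" "f \<in> borel_measurable (\<Pi>\<^sub>M v\<in>V. lborel)"
    and f: "\<And>\<tau>. norm (f \<tau>) \<le> C * exp (- \<eta> * coord_norm V \<tau>)"
  shows "integrable (\<Pi>\<^sub>M v\<in>V. lborel) f"
    and "norm (LINT \<tau>|(\<Pi>\<^sub>M v\<in>V. lborel). f \<tau>) \<le>
      C * (LINT \<tau>|(\<Pi>\<^sub>M v\<in>V. lborel). exp (- \<eta> * coord_norm V \<tau>))"
proof -
  have int: "integrable (\<Pi>\<^sub>M v\<in>V. lborel) (\<lambda>\<tau>. C * exp (- \<eta> * coord_norm V \<tau>))"
    by (intro integrable_mult_right integrable_exp_coord_norm assms)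
  show intf: "integrable (\<Pi>\<^sub>M v\<in>V. lborel) f"
    by (rule Bochner_Integration.integrable_bound[OF int assms(3)])
      (use f order_trans[OF f abs_ge_self] in auto)
  have "norm (LINT \<tau>|(\<Pi>\<^sub>M v\<in>V. lborel). f \<tau>) \<le> (LINT \<tau>|(\<Pi>\<^sub>M v\<in>V. lborel). norm (f \<tau>))"
    by (rule integral_norm_bound)
  also have "\<dots> \<le> (LINT \<tau>|(\<Pi>\<^sub>M v\<in>V. lborel). C * exp (- \<eta> * coord_norm V \<tau>))"
    by (intro Bochner_Integration.integral_mono integrable_norm intf int f)
  finally show "norm (LINT \<tau>|(\<Pi>\<^sub>M v\<in>V. lborel). f \<tau>) \<le>
      C * (LINT \<tau>|(\<Pi>\<^sub>M v\<in>V. lborel). exp (- \<eta> * coord_norm V \<tau>))"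
    by simp
qed

text \<open>The bound on \<open>f\<close> gives zero boundary values at both ends, and the bound on
  \<open>f'\<close> the integrability required by the fundamental theorem on the whole line.\<close>

lemma integral_derivative_eq_0:
  fixes f f' :: "real \<Rightarrow> complex"
  assumes "\<eta> > 0" and deriv: "\<And>t. (f has_vector_derivative f' t) (at t)"
    and cont: "\<And>t. isCont f' t"
    and f: "\<And>t. norm (f t) \<le> C * exp (- \<eta> * \<bar>t\<bar>)"
    and f': "\<And>t. norm (f' t) \<le> C * exp (- \<eta> * \<bar>t\<bar>)"
  shows "(LINT t|lborel. f' t) = 0"
proof -
  have "f' \<in> borel_measurable borel"
    using cont by (intro borel_measurable_continuous_onI continuous_at_imp_continuous_on) auto
  then have int: "integrable lborel f'"
    by (intro Bochner_Integration.integrable_bound[OF integrable_mult_right[OF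
          integrable_exp_abs[OF assms(1)]], of _ C])
      (use f' order_trans[OF f' abs_ge_self] in auto)
  have lim: "(f \<longlongrightarrow> 0) F" if "filterlim (\<lambda>t :: real. \<bar>t\<bar>) at_top F" for F
  proof -
    have "filterlim (\<lambda>t. - \<eta> * \<bar>t\<bar>) at_bot F"
      using assms(1) that by (intro filterlim_tendsto_neg_mult_at_bot[OF tendsto_const]) auto
    then have "((\<lambda>t. C * exp (- \<eta> * \<bar>t\<bar>)) \<longlongrightarrow> C * 0) F"
      by (intro tendsto_intros filterlim_compose[OF exp_at_bot])
    then have "((\<lambda>t. C * exp (- \<eta> * \<bar>t\<bar>)) \<longlongrightarrow> 0) F" by simp
    then show ?thesis
      by (rule Lim_null_comparison[OF always_eventually[OF allI[OF f]]])
  qed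
  have "(f \<longlongrightarrow> 0) at_top" by (rule lim[OF filterlim_abs_real])
  moreover have "(f \<longlongrightarrow> 0) at_bot"
    by (rule lim, subst filterlim_at_bot_mirror) (simp add: filterlim_abs_real)
  ultimately have "(LBINT x=-\<infinity>..\<infinity>. f' x) = 0 - 0"
    using int deriv cont
    by (intro interval_integral_FTC_integrable[where F = f])
      (auto simp: ereal_tendsto_simps1 set_integrable_def)
  then show ?thesis
    by (simp add: interval_lebesgue_integral_def set_lebesgue_integral_def)
qed

text \<open>Integrating over the coordinate \<open>v\<close> first reduces this to the line:
  \<open>coord_norm V\<close> dominates that one coordinate, so the global bound restricts to every
  line with the same constants.\<close>

lemma integral_partial_derivative_eq_0:
  fixes f f' :: "('v \<Rightarrow> real) \<Rightarrow> complex"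
  assumes V: "finite V" "v \<in> V" and "\<eta> > 0"
    and deriv: "\<And>\<tau> t. ((\<lambda>t. f (\<tau>(v := t))) has_vector_derivative f' (\<tau>(v := t))) (at t)"
    and cont: "\<And>\<tau> t. isCont (\<lambda>t. f' (\<tau>(v := t))) t"
    and f: "\<And>\<tau>. norm (f \<tau>) \<le> C * exp (- \<eta> * coord_norm V \<tau>)"
    and f': "\<And>\<tau>. norm (f' \<tau>) \<le> C * exp (- \<eta> * coord_norm V \<tau>)"
    and meas: "f' \<in> borel_measurable (\<Pi>\<^sub>M v\<in>V. lborel)"
  shows "(LINT \<tau>|(\<Pi>\<^sub>M v\<in>V. lborel). f' \<tau>) = 0"
proof -
  interpret product_sigma_finite "\<lambda>_ :: 'v. lborel :: real measure" ..
  have V': "V = insert v (V - {v})" using V by auto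
  have "C \<ge> 0"
    using f[of "\<lambda>_. 0"] order_trans[OF norm_ge_zero] by (fastforce simp: coord_norm_def)
  have norm: "coord_norm V (x(v := t)) \<ge> \<bar>t\<bar>" for x t
    using member_le_sum[of v V "\<lambda>u. \<bar>(x(v := t)) u\<bar>"] V by (simp add: coord_norm_def)
  have bound: "C * exp (- \<eta> * coord_norm V (x(v := t))) \<le> C * exp (- \<eta> * \<bar>t\<bar>)" for x t
    using norm[where x = x and t = t] \<open>C \<ge> 0\<close> assms(3) by (intro mult_left_mono) auto
  have "integrable (\<Pi>\<^sub>M v\<in>V. lborel) f'"
    by (rule integrable_exp_coord_norm_bound[OF V(1) assms(3) meas f'])
  then have "(LINT \<tau>|(\<Pi>\<^sub>M v\<in>V. lborel). f' \<tau>) =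
      (LINT x|(\<Pi>\<^sub>M v\<in>V - {v}. lborel). (LINT t|lborel. f' (x(v := t))))"
    using product_integral_insert[of "V - {v}" v f'] V(1) V' by simp
  also have "(\<lambda>x. LINT t|lborel. f' (x(v := t))) = (\<lambda>_. 0)"
    using f f' order_trans[OF _ bound]
    by (intro ext integral_derivative_eq_0[OF assms(3) deriv cont]) blast+
  finally show ?thesis by simp
qed

section \<open>The logistic function\<close>

definition softplus :: "real \<Rightarrow> real" where
  "softplus t = ln (1 + exp (2 * t))"

definition logistic :: "real \<Rightarrow> real" where
  "logistic t = 1 / (1 + exp (2 * t))"

lemma exp_minus_softplus: "exp (- softplus t) = logistic t"
  by (simp add: softplus_def logistic_def exp_minus add_pos_pos divide_inverse)

lemma logistic_bounds: "0 \<le> logistic t" "logistic t \<le> 1"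
  by (auto simp: logistic_def field_simps add_pos_pos)

lemma logistic_minus: "logistic (- t) = 1 - logistic t"
proof -
  have "1 + exp (2 * t) \<noteq> 0" "1 + exp (- (2 * t)) \<noteq> 0"
    using exp_gt_zero[of "2 * t"] exp_gt_zero[of "- (2 * t)"] by linarith+
  then show ?thesis by (simp add: logistic_def exp_minus field_simps)
qed

lemma softplus_deriv: "(softplus has_real_derivative 2 * logistic (- t)) (at t)"
proof -
  have "1 + exp (2 * t) > 0" by (simp add: add_pos_pos)
  then show ?thesis
    unfolding softplus_def logistic_minus unfolding logistic_def
    by (auto intro!: derivative_eq_intros simp: field_simps)
qed

lemma softplus_nonneg: "softplus t \<ge> 0"
  by (simp add: softplus_def)

lemma softplus_ge: "softplus t \<ge> 2 * max 0 t"
proof (cases "t \<ge> 0")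
  case True
  have "ln (exp (2 * t)) \<le> softplus t"
    unfolding softplus_def by (subst ln_le_cancel_iff) (auto simp: add_pos_pos)
  then show ?thesis using True by simp
qed (simp add: softplus_nonneg)

text \<open>With \<open>softplus_ge\<close> this says that the piecewise linear approximation of
  \<open>softplus\<close> has an error between 0 and \<open>ln 2\<close>, uniformly in
  \<open>t\<close>; only constants are lost in the decay estimate.\<close>

lemma softplus_le: "softplus t \<le> 2 * max 0 t + ln 2"
proof -
  have "softplus t \<le> ln (2 * exp (2 * max 0 t))"
    unfolding softplus_def by (subst ln_le_cancel_iff) (auto simp: add_pos_pos max_def)
  then show ?thesis by (simp add: ln_mult)
qed

lemma ln_2_cosh: "ln (2 * cosh t) = (softplus t + softplus (- t)) / 2"
proof -
  have "(2 * cosh t) * (2 * cosh t) = (1 + exp (2 * t)) * (1 + exp (- (2 * t)))"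
  proof -
    have "2 * cosh t = exp t + exp (- t)" by (simp add: cosh_def)
    then show ?thesis by (simp add: algebra_simps flip: exp_add)
  qed
  then have "ln ((2 * cosh t) * (2 * cosh t)) = ln ((1 + exp (2 * t)) * (1 + exp (- (2 * t))))"
    by simp
  then show ?thesis
    by (subst (asm) (1 2) ln_mult) (auto simp: softplus_def add_pos_pos add_pos_pos[THEN less_imp_neq, symmetric])
qed

section \<open>Rooted graphs\<close>

text \<open>
  The factor \<open>2 cosh \<tau>\<^sub>v\<close> is treated as an edge from \<open>v\<close> to an additional root \<^const>\<open>None\<close>,
  whose potential is \<open>0\<close>. A pair \<open>(k, b)\<close> is the edge \<open>k\<close> with one of its two orientations.
\<close>

definition potential :: "('v \<Rightarrow> real) \<Rightarrow> 'v option \<Rightarrow> real" where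
  "potential \<tau> o' = (case o' of None \<Rightarrow> 0 | Some v \<Rightarrow> \<tau> v)"

lemma potential_simps [simp]: "potential \<tau> None = 0" "potential \<tau> (Some v) = \<tau> v"
  by (simp_all add: potential_def)

definition ray :: "'v set \<times> bool \<Rightarrow> 'v \<Rightarrow> real" where
  "ray i v = (if snd i then 1 else - 1) * indicat_real (fst i) v"

text \<open>An interface that keeps graph theory out of the analysis. The property
  \<open>component\<close> is what cutting a potential into level sets consumes, and
  \<open>root_edge\<close> makes all ray rates positive when the exponents are.\<close>

locale rooted_graph =
  fixes V :: "'v set" and src dst :: "'n :: finite \<Rightarrow> 'v option" and \<S> :: "'v set set"
  assumes finite_V: "finite V" and V_nonempty: "V \<noteq> {}"
    and src_in: "src k \<in> insert None (Some ` V)"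
    and dst_in: "dst k \<in> insert None (Some ` V)"
    and root_edge: "v \<in> V \<Longrightarrow> \<exists>k. src k = Some v \<and> dst k = None"
    and \<S>_subset: "S \<in> \<S> \<Longrightarrow> S \<subseteq> V \<and> S \<noteq> {}"
    and component: "S \<subseteq> V \<Longrightarrow> S \<noteq> {} \<Longrightarrow> \<exists>C\<in>\<S>. C \<subseteq> S \<and>
      (\<forall>k. src k \<in> Some ` C \<longrightarrow> dst k \<notin> Some ` (S - C)) \<and>
      (\<forall>k. dst k \<in> Some ` C \<longrightarrow> src k \<notin> Some ` (S - C))"
begin

section \<open>Tensions and decay rates of directions\<close>

definition tension :: "('v \<Rightarrow> real) \<Rightarrow> 'n \<times> bool \<Rightarrow> real" where
  "tension \<tau> a = (if snd a then 1 else - 1) * (potential \<tau> (src (fst a)) - potential \<tau> (dst (fst a)))"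

text \<open>Half the exponential decay rate of the integrand in direction \<tau>, because
  \<open>softplus t\<close> grows like \<open>2 * max 0 t\<close>. The complex version
  \<open>crate\<close>, evaluated at a ray, is the \<open>P_S\<close> of the overview.\<close>

definition rate :: "('v \<Rightarrow> real) \<Rightarrow> ('n \<times> bool \<Rightarrow> real) \<Rightarrow> real" where
  "rate \<tau> r = (\<Sum>a\<in>UNIV. max 0 (tension \<tau> a) * r a)"

definition crate :: "('v \<Rightarrow> real) \<Rightarrow> complex ^ ('n \<times> bool) \<Rightarrow> complex" where
  "crate \<tau> p = (\<Sum>a\<in>UNIV. complex_of_real (max 0 (tension \<tau> a)) * p $ a)"

definition rays :: "('v set \<times> bool) set" where
  "rays = \<S> \<times> UNIV"

lemma Re_crate: "Re (crate \<tau> p) = rate \<tau> (\<lambda>a. Re (p $ a))"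
  by (simp add: crate_def rate_def)

lemma finite_rays: "finite rays"
proof -
  have "\<S> \<subseteq> Pow V" using \<S>_subset by blast
  then have "finite \<S>" using finite_V finite_subset by blast
  then show ?thesis by (simp add: rays_def)
qed

lemma src_cases: obtains "src k = None" | v where "src k = Some v" "v \<in> V"
  using src_in[of k] by auto

lemma dst_cases: obtains "dst k = None" | v where "dst k = Some v" "v \<in> V"
  using dst_in[of k] by auto

text \<open>The positive and the negative part of \<tau> are both nondecreasing functions of \<tau>
  that fix the root value 0, so on each arc their tensions never have opposite signs and
  \<open>max 0\<close> is additive on them.\<close>

lemma rate_split: "rate \<tau> r = rate (\<lambda>v. max 0 (\<tau> v)) r + rate (\<lambda>v. min 0 (\<tau> v)) r"
proof -
  have "max 0 (tension \<tau> a) = max 0 (tension (\<lambda>v. max 0 (\<tau> v)) a) + max 0 (tension (\<lambda>v. min 0 (\<tau> v)) a)" for a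
    by (cases "src (fst a)"; cases "dst (fst a)") (auto simp: tension_def max_def min_def)
  then show ?thesis
    by (simp add: rate_def sum.distrib[symmetric] distrib_right[symmetric])
qed

text \<open>Edges inside \<open>C\<close> keep their tension, and edges leaving \<open>C\<close> end
  at potential 0 because \<open>C\<close> is isolated in the support. As \<open>c\<close> does not
  exceed \<theta> on \<open>C\<close>, no tension changes sign when the layer is removed, and
  \<open>max 0\<close> splits additively.\<close>

lemma rate_subtract_component:
  fixes \<theta> :: "'v \<Rightarrow> real"
  assumes nonneg: "\<And>v. v \<in> V \<Longrightarrow> \<theta> v \<ge> 0" and C: "C \<subseteq> {v \<in> V. \<theta> v > 0}"
    and isolated: "\<And>k. src k \<in> Some ` C \<Longrightarrow> dst k \<notin> Some ` ({v \<in> V. \<theta> v > 0} - C)"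
      "\<And>k. dst k \<in> Some ` C \<Longrightarrow> src k \<notin> Some ` ({v \<in> V. \<theta> v > 0} - C)"
    and c: "c \<ge> 0" "\<And>v. v \<in> C \<Longrightarrow> c \<le> \<theta> v" and s: "s = 1 \<or> s = - 1"
  shows "rate (\<lambda>v. s * \<theta> v) r = rate (\<lambda>v. s * (\<theta> v - c * indicat_real C v)) r +
    c * rate (\<lambda>v. s * indicat_real C v) r"
proof -
  have out: "\<theta> v = 0" if "v \<in> V" "v \<notin> {v \<in> V. \<theta> v > 0} - C" "v \<notin> C" for v
    using nonneg[of v] that by force
  have "max 0 (tension (\<lambda>v. s * \<theta> v) a) = max 0 (tension (\<lambda>v. s * (\<theta> v - c * indicat_real C v)) a) +
      c * max 0 (tension (\<lambda>v. s * indicat_real C v) a)" for a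
  proof -
    obtain k b where a: "a = (k, b)" by (cases a)
    consider "src k \<in> Some ` C" "dst k \<in> Some ` C" | "src k \<notin> Some ` C" "dst k \<notin> Some ` C"
      | "src k \<in> Some ` C" "dst k \<notin> Some ` C" | "src k \<notin> Some ` C" "dst k \<in> Some ` C"
      by blast
    then show ?thesis
    proof cases
      case 1
      then show ?thesis by (auto simp: a tension_def algebra_simps)
    next
      case 2
      then show ?thesis
        by (cases "src k"; cases "dst k") (auto simp: a tension_def indicator_def image_iff)
    next
      case 3
      then obtain v where v: "src k = Some v" "v \<in> C" by blast
      have "dst k = None \<or> (\<exists>v. dst k = Some v \<and> v \<notin> C \<and> \<theta> v = 0)"
      proof (cases "dst k")
        case (Some v')
        then have "v' \<in> V" "v' \<notin> C" using dst_in[of k] 3 by auto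
        moreover have "v' \<notin> {v \<in> V. \<theta> v > 0} - C" using isolated(1)[of k] 3 Some by blast
        ultimately show ?thesis using Some out by blast
      qed simp
      then have "potential (\<lambda>v. s * \<theta> v) (dst k) = 0"
        "potential (\<lambda>v. s * indicat_real C v) (dst k) = 0"
        "potential (\<lambda>v. s * (\<theta> v - c * indicat_real C v)) (dst k) = 0"
        by (auto simp: indicator_def)
      then show ?thesis
        using v c(1) c(2)[of v] s by (auto simp: a tension_def max_def)
    next
      case 4
      then obtain v where v: "dst k = Some v" "v \<in> C" by blast
      have "src k = None \<or> (\<exists>v. src k = Some v \<and> v \<notin> C \<and> \<theta> v = 0)"
      proof (cases "src k")
        case (Some v')
        then have "v' \<in> V" "v' \<notin> C" using src_in[of k] 4 by auto
        moreover have "v' \<notin> {v \<in> V. \<theta> v > 0} - C" using isolated(2)[of k] 4 Some by blast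
        ultimately show ?thesis using Some out by blast
      qed simp
      then have "potential (\<lambda>v. s * \<theta> v) (src k) = 0"
        "potential (\<lambda>v. s * indicat_real C v) (src k) = 0"
        "potential (\<lambda>v. s * (\<theta> v - c * indicat_real C v)) (src k) = 0"
        by (auto simp: indicator_def)
      then show ?thesis
        using v c(1) c(2)[of v] s by (auto simp: a tension_def max_def)
    qed
  qed
  then show ?thesis
    by (simp add: rate_def sum_distrib_left sum.distrib[symmetric] distrib_right[symmetric] mult_ac)
      (simp add: algebra_simps sum.distrib)
qed

text \<open>
  Layer-cake induction: a connected component of the support, with the minimum of the potential
  on it as coefficient, is split off at each step.
\<close>

lemma rate_nonneg_potential:
  assumes r: "\<And>C. C \<in> \<S> \<Longrightarrow> rate (\<lambda>v. s * indicat_real C v) r \<ge> \<epsilon>" and \<epsilon>: "\<epsilon> > 0"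
    and s: "s = 1 \<or> s = - 1" and nonneg: "\<And>v. v \<in> V \<Longrightarrow> \<theta> v \<ge> 0"
  shows "\<epsilon> * (\<Sum>v\<in>V. \<theta> v) \<le> card V * rate (\<lambda>v. s * \<theta> v) r"
  using nonneg
proof (induction "card {v \<in> V. \<theta> v > 0}" arbitrary: \<theta> rule: less_induct)
  case (less \<theta>)
  let ?S = "{v \<in> V. \<theta> v > 0}"
  show ?case
  proof (cases "?S = {}")
    case True
    then have zero: "\<theta> v = 0" if "v \<in> V" for v using less.prems[OF that] that by force
    have "tension (\<lambda>v. s * \<theta> v) a = 0" for a
      by (rule src_cases[of "fst a"]; rule dst_cases[of "fst a"]) (simp_all add: tension_def zero)
    then show ?thesis using zero by (simp add: rate_def)
  next
    case False
    obtain C where C: "C \<in> \<S>" "C \<subseteq> ?S"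
      "\<And>k. src k \<in> Some ` C \<Longrightarrow> dst k \<notin> Some ` (?S - C)"
      "\<And>k. dst k \<in> Some ` C \<Longrightarrow> src k \<notin> Some ` (?S - C)"
      using component[of ?S] False by blast
    have fin: "finite C" "C \<noteq> {}"
      using \<S>_subset[OF C(1)] finite_V finite_subset by auto
    define c where "c = Min (\<theta> ` C)"
    have c: "c > 0" "\<And>v. v \<in> C \<Longrightarrow> c \<le> \<theta> v"
      using fin C(2) by (auto simp: c_def)
    define \<theta>' where "\<theta>' = (\<lambda>v. \<theta> v - c * indicat_real C v)"
    have nonneg: "\<theta>' v \<ge> 0" if "v \<in> V" for v
      using less.prems[OF that] c(2)[of v] by (auto simp: \<theta>'_def indicator_def)
    \<comment> \<open>A vertex attaining the minimum leaves the support, which makes the induction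
      measure drop.\<close>
    have "c \<in> \<theta> ` C" unfolding c_def using fin by (intro Min_in) auto
    then obtain u where u: "u \<in> C" "\<theta> u = c" by blast
    have "{v \<in> V. \<theta>' v > 0} \<subset> ?S"
    proof
      show "{v \<in> V. \<theta>' v > 0} \<subseteq> ?S"
        using c(1) by (auto simp: \<theta>'_def indicator_def split: if_splits)
      have "u \<in> ?S" "\<theta>' u = 0" using u C(2) by (auto simp: \<theta>'_def)
      then show "{v \<in> V. \<theta>' v > 0} \<noteq> ?S"
        by (metis (mono_tags, lifting) less_irrefl mem_Collect_eq)
    qed
    then have "card {v \<in> V. \<theta>' v > 0} < card ?S"
      using finite_V by (intro psubset_card_mono) auto
    then have IH: "\<epsilon> * (\<Sum>v\<in>V. \<theta>' v) \<le> card V * rate (\<lambda>v. s * \<theta>' v) r"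
      using less.hyps nonneg by blast
    \<comment> \<open>The origin of the factor \<open>card V\<close>: removing a layer lowers the
      sum of the potential by at most \<open>c * card V\<close>, while the rate drops by at least
      \<open>c * \<epsilon>\<close>.\<close>
    have "(\<Sum>v\<in>V. c * indicat_real C v) = c * card (V \<inter> C)"
      using finite_V by (simp add: sum_distrib_left[symmetric] indicator_def sum.If_cases Int_def)
    also have "\<dots> \<le> c * card V"
      using c(1) finite_V by (intro mult_left_mono) (auto intro: card_mono)
    finally have "\<epsilon> * (\<Sum>v\<in>V. c * indicat_real C v) \<le> \<epsilon> * (c * card V)"
      using \<epsilon> by (intro mult_left_mono) auto
    also have "\<dots> \<le> card V * (c * rate (\<lambda>v. s * indicat_real C v) r)"
      using r[OF C(1)] c(1) mult_left_mono[of \<epsilon> "rate (\<lambda>v. s * indicat_real C v) r" "c * card V"]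
      by (simp add: mult_ac)
    finally have "\<epsilon> * (\<Sum>v\<in>V. \<theta>' v) + \<epsilon> * (\<Sum>v\<in>V. c * indicat_real C v) \<le>
        card V * (rate (\<lambda>v. s * \<theta>' v) r + c * rate (\<lambda>v. s * indicat_real C v) r)"
      using IH by (simp add: distrib_left)
    moreover have "rate (\<lambda>v. s * \<theta> v) r =
        rate (\<lambda>v. s * \<theta>' v) r + c * rate (\<lambda>v. s * indicat_real C v) r"
      unfolding \<theta>'_def using less.prems C(2-4) c s by (intro rate_subtract_component) auto
    moreover have "(\<Sum>v\<in>V. \<theta> v) = (\<Sum>v\<in>V. \<theta>' v) + (\<Sum>v\<in>V. c * indicat_real C v)"
      by (simp add: \<theta>'_def sum.distrib[symmetric])
    ultimately show ?thesis by (simp add: distrib_left)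
  qed
qed

text \<open>This turns positivity on finitely many rays into coercivity in every direction, with the
  positive and negative parts of \<tau> treated separately.\<close>

lemma rate_lower_bound:
  assumes r: "\<And>i. i \<in> rays \<Longrightarrow> rate (ray i) r \<ge> \<epsilon>" and \<epsilon>: "\<epsilon> > 0"
  shows "\<epsilon> * coord_norm V \<tau> \<le> card V * rate \<tau> r"
proof -
  have pos: "rate (\<lambda>v. 1 * indicat_real C v) r \<ge> \<epsilon>" and neg: "rate (\<lambda>v. - 1 * indicat_real C v) r \<ge> \<epsilon>"
    if "C \<in> \<S>" for C
    using r[of "(C, True)"] r[of "(C, False)"] that by (auto simp: rays_def ray_def[abs_def])
  have "\<epsilon> * (\<Sum>v\<in>V. max 0 (\<tau> v)) \<le> card V * rate (\<lambda>v. 1 * max 0 (\<tau> v)) r"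
    by (rule rate_nonneg_potential[OF pos \<epsilon>]) auto
  moreover have "\<epsilon> * (\<Sum>v\<in>V. max 0 (- \<tau> v)) \<le> card V * rate (\<lambda>v. - 1 * max 0 (- \<tau> v)) r"
    by (rule rate_nonneg_potential[OF neg \<epsilon>]) auto
  moreover have "(\<lambda>v. - 1 * max 0 (- \<tau> v)) = (\<lambda>v. min 0 (\<tau> v))"
    by (auto simp: max_def min_def)
  moreover have "coord_norm V \<tau> = (\<Sum>v\<in>V. max 0 (\<tau> v)) + (\<Sum>v\<in>V. max 0 (- \<tau> v))"
    unfolding coord_norm_def sum.distrib[symmetric] by (intro sum.cong) auto
  ultimately show ?thesis
    by (simp add: rate_split[of \<tau>] distrib_left)
qed

text \<open>The root edge at any vertex of the ray's set, suitably oriented, contributes a strictly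
  positive summand.\<close>

lemma rate_ray_pos:
  assumes "i \<in> rays" "\<And>a. r a > 0"
  shows "rate (ray i) r > 0"
proof -
  obtain S s where i: "i = (S, s)" "S \<in> \<S>" using assms(1) by (auto simp: rays_def)
  then obtain v where v: "v \<in> S" "v \<in> V" using \<S>_subset by blast
  then obtain k where k: "src k = Some v" "dst k = None" using root_edge by blast
  have "tension (ray i) (k, s) = 1" using v k by (simp add: i tension_def ray_def)
  then show ?thesis
    unfolding rate_def using assms(2) less_imp_le[OF assms(2)]
    by (intro sum_pos2[of _ "(k, s)"]) auto
qed

lemma tension_ray: "tension (ray i) a = 0 \<or> tension (ray i) a = 1 \<or> tension (ray i) a = - 1"
  by (cases "src (fst a)"; cases "dst (fst a)") (simp_all add: tension_def ray_def indicator_def)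

lemma max_tension_ray: "max 0 (tension (ray i) a) = (if tension (ray i) a > 0 then 1 else 0)"
  using tension_ray[of i a] by auto

end

section \<open>The integral with independent exponents for the two orientations\<close>

context rooted_graph
begin

abbreviation vmeasure :: "('v \<Rightarrow> real) measure" where
  "vmeasure \<equiv> \<Pi>\<^sub>M v\<in>V. lborel"

definition arc_kernel :: "complex ^ ('n \<times> bool) \<Rightarrow> ('v \<Rightarrow> real) \<Rightarrow> complex" where
  "arc_kernel p \<tau> = exp (- (\<Sum>a\<in>UNIV. p $ a * complex_of_real (softplus (tension \<tau> a))))"

definition arc_integral :: "complex ^ ('n \<times> bool) \<Rightarrow> complex" where
  "arc_integral p = (LINT \<tau>|vmeasure. arc_kernel p \<tau>)"

text \<open>For \<open>M = 0\<close> this is the domain of convergence. A separate bound for each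
  ray allows the continuation to advance in one ray at a time.\<close>

definition halfspaces :: "('v set \<times> bool \<Rightarrow> nat) \<Rightarrow> (complex ^ ('n \<times> bool)) set" where
  "halfspaces M = {p. \<forall>i\<in>rays. Re (crate (ray i) p) > - real (M i)}"

definition flip :: "'n \<times> bool \<Rightarrow> 'n \<times> bool" where
  "flip a = (fst a, \<not> snd a)"

lemma arc_kernel_add: "arc_kernel (p + h) \<tau> = arc_kernel p \<tau> * arc_kernel h \<tau>"
  by (simp add: arc_kernel_def distrib_right sum.distrib exp_add[symmetric])

text \<open>Together with \<open>arc_kernel_add\<close>, this converts the logistic factors produced
  by differentiation into exponent shifts.\<close>

lemma arc_kernel_axis: "arc_kernel (axis a 1) \<tau> = complex_of_real (logistic (tension \<tau> a))"
proof -
  have "(\<Sum>b\<in>UNIV. axis a 1 $ b * complex_of_real (softplus (tension \<tau> b))) =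
      (\<Sum>b\<in>UNIV. if b = a then complex_of_real (softplus (tension \<tau> b)) else 0)"
    by (intro sum.cong) (auto simp: axis_def)
  also have "\<dots> = complex_of_real (softplus (tension \<tau> a))" by simp
  finally have "arc_kernel (axis a 1) \<tau> = complex_of_real (exp (- softplus (tension \<tau> a)))"
    by (simp add: arc_kernel_def exp_of_real flip: of_real_minus)
  then show ?thesis by (simp add: exp_minus_softplus)
qed

lemma measurable_potential:
  assumes "o' \<in> insert None (Some ` V)"
  shows "(\<lambda>\<tau>. potential \<tau> o') \<in> borel_measurable vmeasure"
  using assms by auto

lemma measurable_tension [measurable]: "(\<lambda>\<tau>. tension \<tau> a) \<in> borel_measurable vmeasure"
  unfolding tension_def using measurable_potential[OF src_in] measurable_potential[OF dst_in]
  by (intro borel_measurable_times borel_measurable_diff) auto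

lemma measurable_softplus_tension [measurable]:
  "(\<lambda>\<tau>. softplus (tension \<tau> a)) \<in> borel_measurable vmeasure"
  unfolding softplus_def by measurable

lemma measurable_logistic_tension [measurable]:
  "(\<lambda>\<tau>. logistic (tension \<tau> a)) \<in> borel_measurable vmeasure"
  unfolding logistic_def by measurable

lemma measurable_arc_kernel [measurable]: "arc_kernel p \<in> borel_measurable vmeasure"
  unfolding arc_kernel_def[abs_def] by measurable

lemma abs_potential_le:
  "o' \<in> insert None (Some ` V) \<Longrightarrow> \<bar>potential \<tau> o'\<bar> \<le> coord_norm V \<tau>"
  using member_le_sum[of _ V "\<lambda>v. \<bar>\<tau> v\<bar>"] finite_V
  by (auto simp: coord_norm_def intro: sum_nonneg)

lemma abs_tension_le: "\<bar>tension \<tau> a\<bar> \<le> 2 * coord_norm V \<tau>"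
  using abs_potential_le[OF src_in, of \<tau> "fst a"] abs_potential_le[OF dst_in, of \<tau> "fst a"]
  by (auto simp: tension_def)

lemma softplus_tension_le: "softplus (tension \<tau> a) \<le> 4 * coord_norm V \<tau> + ln 2"
  using softplus_le[of "tension \<tau> a"] abs_tension_le[of \<tau> a] by linarith

lemma arc_kernel_bound:
  assumes "p \<in> halfspaces (\<lambda>_. 0)"
  shows "\<exists>\<eta>>0. \<exists>C. \<forall>\<tau>. norm (arc_kernel p \<tau>) \<le> C * exp (- \<eta> * coord_norm V \<tau>)"
proof -
  \<comment> \<open>Inserting 1 keeps the set nonempty for \<open>Min\<close> without a case
    distinction on \<open>rays\<close>.\<close>
  define \<epsilon> where "\<epsilon> = Min (insert 1 ((\<lambda>i. Re (crate (ray i) p)) ` rays))"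
  have \<epsilon>: "\<epsilon> > 0" "\<And>i. i \<in> rays \<Longrightarrow> rate (ray i) (\<lambda>a. Re (p $ a)) \<ge> \<epsilon>"
    using finite_rays assms by (auto simp: \<epsilon>_def halfspaces_def simp flip: Re_crate)
  have card: "card V > 0" using finite_V V_nonempty by (simp add: card_gt_0_iff)
  define \<eta> where "\<eta> = 2 * \<epsilon> / card V"
  define C where "C = exp (\<Sum>a\<in>UNIV. \<bar>Re (p $ a)\<bar> * ln 2)"
  have "norm (arc_kernel p \<tau>) \<le> C * exp (- \<eta> * coord_norm V \<tau>)" for \<tau>
  proof -
    \<comment> \<open>Individual exponents may have negative real part, since only the rates are
      known to be positive; the error of the linear approximation is therefore weighted by the
      absolute value.\<close>
    have termwise: "- (Re (p $ a) * softplus (tension \<tau> a)) \<le>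
        \<bar>Re (p $ a)\<bar> * ln 2 - 2 * (max 0 (tension \<tau> a) * Re (p $ a))" for a
    proof -
      define e where "e = softplus (tension \<tau> a) - 2 * max 0 (tension \<tau> a)"
      have e: "0 \<le> e" "e \<le> ln 2"
        using softplus_ge[of "tension \<tau> a"] softplus_le[of "tension \<tau> a"] by (auto simp: e_def)
      have "- (Re (p $ a) * e) \<le> \<bar>Re (p $ a)\<bar> * e"
        using e abs_ge_minus_self[of "Re (p $ a)"] mult_right_mono[of "- Re (p $ a)" _ e] by simp
      also have "\<dots> \<le> \<bar>Re (p $ a)\<bar> * ln 2" using e by (intro mult_left_mono) auto
      finally show ?thesis by (simp add: e_def algebra_simps)
    qed
    have "\<epsilon> * coord_norm V \<tau> \<le> card V * rate \<tau> (\<lambda>a. Re (p $ a))"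
      by (rule rate_lower_bound) (use \<epsilon> in auto)
    then have rate: "2 * rate \<tau> (\<lambda>a. Re (p $ a)) \<ge> \<eta> * coord_norm V \<tau>"
      using card by (simp add: \<eta>_def field_simps)
    have "norm (arc_kernel p \<tau>) = exp (\<Sum>a\<in>UNIV. - (Re (p $ a) * softplus (tension \<tau> a)))"
      by (simp add: arc_kernel_def sum_negf)
    also have "\<dots> \<le> exp (\<Sum>a\<in>UNIV. \<bar>Re (p $ a)\<bar> * ln 2 - 2 * (max 0 (tension \<tau> a) * Re (p $ a)))"
      by (simp only: exp_le_cancel_iff) (intro sum_mono termwise)
    also have "\<dots> = C * exp (- (2 * rate \<tau> (\<lambda>a. Re (p $ a))))"
      by (simp add: C_def rate_def sum_subtractf sum_distrib_left flip: exp_add)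
    also have "\<dots> \<le> C * exp (- \<eta> * coord_norm V \<tau>)"
      using rate by (simp add: C_def)
    finally show ?thesis .
  qed
  moreover have "\<eta> > 0" using \<epsilon> card by (simp add: \<eta>_def)
  ultimately show ?thesis by blast
qed

lemma integrable_arc_kernel:
  assumes "p \<in> halfspaces (\<lambda>_. 0)"
  shows "integrable vmeasure (arc_kernel p)"
proof -
  obtain \<eta> C where "\<eta> > 0" "\<And>\<tau>. norm (arc_kernel p \<tau>) \<le> C * exp (- \<eta> * coord_norm V \<tau>)"
    using arc_kernel_bound[OF assms] by blast
  then show ?thesis
    by (rule integrable_exp_coord_norm_bound(1)[OF finite_V _ measurable_arc_kernel])
qed

text \<open>A quadratic Taylor estimate of the perturbing exponential bounds the remainder by
  \<open>(norm h)\<^sup>2\<close> times an integrable function independent of \<open>h\<close>. All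
  exponents are perturbed together, so joint complex differentiability results directly.\<close>

lemma cdiff_arc_integral:
  assumes p: "p \<in> halfspaces (\<lambda>_. 0)"
  shows "cdiff arc_integral p"
proof -
  obtain \<eta> C where \<eta>: "\<eta> > 0" and C: "\<And>\<tau>. norm (arc_kernel p \<tau>) \<le> C * exp (- \<eta> * coord_norm V \<tau>)"
    using arc_kernel_bound[OF p] by blast
  have C0: "C \<ge> 0"
    using C[of "\<lambda>_. 0"] order_trans[OF norm_ge_zero] by (fastforce simp: coord_norm_def)
  define m where "m = real CARD('n \<times> bool)"
  define \<Lambda> where "\<Lambda> = (\<lambda>\<tau>. \<Sum>a\<in>UNIV. softplus (tension \<tau> a))"
  \<comment> \<open>As \<open>\<Lambda> \<tau> \<le> m * (4 * coord_norm V \<tau> + ln 2)\<close>,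
    the 16 makes \<open>exp (2 * \<delta> * \<Lambda> \<tau>)\<close> consume exactly half of the
    decay \<eta>, up to a constant. Of its two factors
    \<open>exp (\<delta> * \<Lambda> \<tau>)\<close>, one bounds the perturbing exponential and the
    other absorbs the square of \<open>\<Lambda> \<tau>\<close>.\<close>
  define \<delta> where "\<delta> = \<eta> / (16 * m)"
  have m: "m > 0" by (simp add: m_def)
  have \<delta>: "\<delta> > 0" using \<eta> m by (simp add: \<delta>_def)
  have \<Lambda>0: "\<Lambda> \<tau> \<ge> 0" for \<tau> by (simp add: \<Lambda>_def sum_nonneg softplus_nonneg)
  have \<Lambda>1: "softplus (tension \<tau> a) \<le> \<Lambda> \<tau>" for \<tau> a
    unfolding \<Lambda>_def by (rule member_le_sum) (auto simp: softplus_nonneg)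
  have "\<Lambda> \<tau> \<le> m * (4 * coord_norm V \<tau> + ln 2)" for \<tau>
    unfolding \<Lambda>_def m_def by (rule sum_bounded_above) (rule softplus_tension_le)
  from mult_left_mono[OF this, of "2 * \<delta>"]
  have \<Lambda>2: "2 * \<delta> * \<Lambda> \<tau> \<le> \<eta> / 2 * coord_norm V \<tau> + 2 * \<delta> * m * ln 2" for \<tau>
    using \<delta> m by (simp add: \<delta>_def field_simps)
  define K where "K = C * exp (2 * \<delta> * m * ln 2)"
  have K: "norm (arc_kernel p \<tau>) * exp (2 * \<delta> * \<Lambda> \<tau>) \<le> K * exp (- (\<eta> / 2) * coord_norm V \<tau>)" for \<tau>
  proof -
    have "norm (arc_kernel p \<tau>) * exp (2 * \<delta> * \<Lambda> \<tau>) \<le>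
        (C * exp (- \<eta> * coord_norm V \<tau>)) * exp (\<eta> / 2 * coord_norm V \<tau> + 2 * \<delta> * m * ln 2)"
      using C \<Lambda>2 C0 by (intro mult_mono) auto
    also have "\<dots> = K * exp (- (\<eta> / 2) * coord_norm V \<tau>)"
      by (simp add: K_def field_simps flip: exp_add)
    finally show ?thesis .
  qed
  have first_order: "integrable vmeasure (\<lambda>\<tau>. arc_kernel p \<tau> * complex_of_real (softplus (tension \<tau> a)))" for a
  proof (rule integrable_exp_coord_norm_bound(1)[where \<eta> = "\<eta> / 2" and C = "K / \<delta>"])
    fix \<tau>
    have "\<delta> * softplus (tension \<tau> a) \<le> \<delta> * \<Lambda> \<tau>" using \<Lambda>1 \<delta> by simp
    also have "\<dots> \<le> exp (2 * \<delta> * \<Lambda> \<tau>)"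
      using exp_ge_add_one_self[of "2 * \<delta> * \<Lambda> \<tau>"] \<delta> mult_nonneg_nonneg[of \<delta> "\<Lambda> \<tau>"] \<Lambda>0[of \<tau>] by linarith
    finally have "norm (arc_kernel p \<tau>) * softplus (tension \<tau> a) \<le>
        norm (arc_kernel p \<tau>) * (exp (2 * \<delta> * \<Lambda> \<tau>) / \<delta>)"
      using \<delta> by (intro mult_left_mono) (auto simp: field_simps)
    also have "\<dots> \<le> K / \<delta> * exp (- (\<eta> / 2) * coord_norm V \<tau>)"
      using K[of \<tau>] \<delta> by (simp add: field_simps)
    finally show "norm (arc_kernel p \<tau> * complex_of_real (softplus (tension \<tau> a))) \<le>
        K / \<delta> * exp (- (\<eta> / 2) * coord_norm V \<tau>)"
      by (simp add: norm_mult softplus_nonneg)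
  qed (use \<eta> finite_V in auto)
  define c where "c = (\<lambda>a. LINT \<tau>|vmeasure. arc_kernel p \<tau> * complex_of_real (softplus (tension \<tau> a)))"
  define D where "D = (\<lambda>h. - (\<Sum>a\<in>UNIV. h $ a * c a))"
  define lin where "lin = (\<lambda>h \<tau>. \<Sum>a\<in>UNIV. h $ a * complex_of_real (softplus (tension \<tau> a)))"
  define R where "R = (\<lambda>h \<tau>. arc_kernel (p + h) \<tau> - arc_kernel p \<tau> + arc_kernel p \<tau> * lin h \<tau>)"
  define I where "I = (LINT \<tau>|vmeasure. exp (- (\<eta> / 2) * coord_norm V \<tau>))"
  have lin_measurable [measurable]: "lin h \<in> borel_measurable vmeasure" for h
    unfolding lin_def by measurable
  have R_bound: "norm (R h \<tau>) \<le> (norm h)\<^sup>2 * (2 / \<delta>\<^sup>2 * K) * exp (- (\<eta> / 2) * coord_norm V \<tau>)"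
    if h: "norm h \<le> \<delta>" for h \<tau>
  proof -
    have lin: "norm (lin h \<tau>) \<le> norm h * \<Lambda> \<tau>"
      unfolding lin_def \<Lambda>_def sum_distrib_left
      by (intro order_trans[OF norm_sum] sum_mono)
        (auto simp: norm_mult softplus_nonneg intro!: mult_right_mono Finite_Cartesian_Product.norm_nth_le)
    have "norm h * \<Lambda> \<tau> \<le> \<delta> * \<Lambda> \<tau>" using h \<Lambda>0 by (intro mult_right_mono)
    with lin have lin': "norm (lin h \<tau>) \<le> \<delta> * \<Lambda> \<tau>" by linarith
    have "norm (exp (- lin h \<tau>) - (\<Sum>i\<le>1. (- lin h \<tau>) ^ i / fact i)) \<le>
        exp (norm (- lin h \<tau>)) * norm (- lin h \<tau>) ^ Suc 1 / fact 1"
      by (rule Taylor_exp_field)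
    then have "norm (exp (- lin h \<tau>) - 1 + lin h \<tau>) \<le> exp (norm (lin h \<tau>)) * (norm (lin h \<tau>))\<^sup>2"
      by (simp add: power2_eq_square algebra_simps)
    also have "\<dots> \<le> exp (\<delta> * \<Lambda> \<tau>) * (norm h * \<Lambda> \<tau>)\<^sup>2"
      using lin lin' by (intro mult_mono power_mono) auto
    also have "\<dots> \<le> exp (\<delta> * \<Lambda> \<tau>) * ((norm h)\<^sup>2 * (2 / \<delta>\<^sup>2 * exp (\<delta> * \<Lambda> \<tau>)))"
    proof -
      have nonneg: "\<delta> * \<Lambda> \<tau> \<ge> 0" using \<delta> \<Lambda>0[of \<tau>] by simp
      have "(\<delta> * \<Lambda> \<tau>)\<^sup>2 / 2 \<le> exp (\<delta> * \<Lambda> \<tau>)"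
        using exp_lower_Taylor_quadratic[OF nonneg] nonneg by linarith
      then have "(\<Lambda> \<tau>)\<^sup>2 \<le> 2 / \<delta>\<^sup>2 * exp (\<delta> * \<Lambda> \<tau>)"
        using \<delta> by (simp add: power_mult_distrib field_simps)
      then show ?thesis unfolding power_mult_distrib by (intro mult_left_mono) auto
    qed
    also have "\<dots> = (norm h)\<^sup>2 * (2 / \<delta>\<^sup>2) * exp (2 * \<delta> * \<Lambda> \<tau>)"
      using exp_add[of "\<delta> * \<Lambda> \<tau>" "\<delta> * \<Lambda> \<tau>"] by (simp add: mult_ac)
    finally have *: "norm (exp (- lin h \<tau>) - 1 + lin h \<tau>) \<le> \<dots>" .
    have R: "R h \<tau> = arc_kernel p \<tau> * (exp (- lin h \<tau>) - 1 + lin h \<tau>)"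
      unfolding R_def arc_kernel_add by (simp add: arc_kernel_def lin_def algebra_simps)
    have "norm (R h \<tau>) \<le> norm (arc_kernel p \<tau>) * ((norm h)\<^sup>2 * (2 / \<delta>\<^sup>2) * exp (2 * \<delta> * \<Lambda> \<tau>))"
      unfolding R norm_mult by (intro mult_left_mono *) simp
    also have "\<dots> = (norm h)\<^sup>2 * (2 / \<delta>\<^sup>2) * (norm (arc_kernel p \<tau>) * exp (2 * \<delta> * \<Lambda> \<tau>))"
      by (simp add: mult_ac)
    also have "\<dots> \<le> (norm h)\<^sup>2 * (2 / \<delta>\<^sup>2) * (K * exp (- (\<eta> / 2) * coord_norm V \<tau>))"
      by (intro mult_left_mono K) auto
    finally show ?thesis by (simp add: mult_ac)
  qed
  have remainder: "norm (arc_integral (p + h) - arc_integral p - D h) \<le> (norm h)\<^sup>2 * (2 / \<delta>\<^sup>2 * K) * I"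
    if h: "norm h \<le> \<delta>" for h
  proof -
    have [measurable]: "R h \<in> borel_measurable vmeasure" unfolding R_def by measurable
    have half: "\<eta> / 2 > 0" using \<eta> by simp
    note R = integrable_exp_coord_norm_bound[OF finite_V half _ R_bound[OF h], simplified I_def[symmetric]]
    have int_lin: "integrable vmeasure (\<lambda>\<tau>. arc_kernel p \<tau> * lin h \<tau>)"
    proof -
      have "integrable vmeasure (\<lambda>\<tau>. \<Sum>a\<in>UNIV. h $ a * (arc_kernel p \<tau> * complex_of_real (softplus (tension \<tau> a))))"
        by (intro Bochner_Integration.integrable_sum integrable_mult_right first_order)
      then show ?thesis by (simp add: lin_def sum_distrib_left mult_ac)
    qed
    have "(LINT \<tau>|vmeasure. arc_kernel p \<tau> * lin h \<tau>) =
        (LINT \<tau>|vmeasure. (\<Sum>a\<in>UNIV. h $ a * (arc_kernel p \<tau> * complex_of_real (softplus (tension \<tau> a)))))"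
      by (simp add: lin_def sum_distrib_left mult_ac)
    also have "\<dots> = - D h"
      by (subst Bochner_Integration.integral_sum)
        (auto intro: first_order integrable_mult_right simp: D_def c_def)
    finally have D: "(LINT \<tau>|vmeasure. arc_kernel p \<tau> * lin h \<tau>) = - D h" .
    have "arc_kernel (p + h) = (\<lambda>\<tau>. R h \<tau> + arc_kernel p \<tau> - arc_kernel p \<tau> * lin h \<tau>)"
      by (auto simp: R_def)
    then have "arc_integral (p + h) = (LINT \<tau>|vmeasure. R h \<tau> + arc_kernel p \<tau> - arc_kernel p \<tau> * lin h \<tau>)"
      by (simp add: arc_integral_def)
    also have "\<dots> = (LINT \<tau>|vmeasure. R h \<tau>) + arc_integral p + D h"
      using R(1) integrable_arc_kernel[OF p] int_lin by (simp add: arc_integral_def D)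
    finally show ?thesis using R(2) by simp
  qed
  have "(arc_integral has_derivative D) (at p)"
  proof (rule has_derivativeI_sandwich[OF \<delta>, where H = "\<lambda>y. (2 / \<delta>\<^sup>2 * K) * I * norm (y - p)"])
    show "bounded_linear D"
      unfolding D_def
      by (intro bounded_linear_minus bounded_linear_sum bounded_linear_mult_const bounded_linear_vec_nth)
    show "((\<lambda>y. (2 / \<delta>\<^sup>2 * K) * I * norm (y - p)) \<longlongrightarrow> 0) (at p)"
      using \<delta> by (auto intro!: tendsto_eq_intros)
    fix y assume "y \<noteq> p" "dist y p < \<delta>"
    then show "norm (arc_integral y - arc_integral p - D (y - p)) / norm (y - p) \<le>
        (2 / \<delta>\<^sup>2 * K) * I * norm (y - p)"
      using remainder[of "y - p"] by (simp add: dist_norm divide_le_eq power2_eq_square mult_ac)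
  qed
  then show ?thesis
    by (rule cdiffI) (simp add: D_def sum_distrib_left mult_ac)
qed

section \<open>Integration by parts along a potential\<close>

lemma tension_fun_upd:
  "tension (\<tau>(v := t)) a = tension (\<tau>(v := 0)) a + t * tension (indicat_real {v}) a"
  by (cases "src (fst a)"; cases "dst (fst a)") (simp_all add: tension_def indicator_def algebra_simps)

lemma potential_decompose:
  assumes "o' \<in> insert None (Some ` V)"
  shows "(\<Sum>v\<in>V. \<theta> v * potential (indicat_real {v}) o') = potential \<theta> o'"
  using assms
proof
  assume "o' \<in> Some ` V"
  then obtain u where u: "o' = Some u" "u \<in> V" by blast
  have "(\<Sum>v\<in>V. \<theta> v * potential (indicat_real {v}) o') = (\<Sum>v\<in>V. if v = u then \<theta> v else 0)"
    by (intro sum.cong) (auto simp: u indicator_def)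
  then show ?thesis using u finite_V by simp
qed simp

lemma tension_decompose: "(\<Sum>v\<in>V. \<theta> v * tension (indicat_real {v}) a) = tension \<theta> a"
proof -
  have "(\<Sum>v\<in>V. \<theta> v * tension (indicat_real {v}) a) = (if snd a then 1 else - 1) *
      ((\<Sum>v\<in>V. \<theta> v * potential (indicat_real {v}) (src (fst a))) -
       (\<Sum>v\<in>V. \<theta> v * potential (indicat_real {v}) (dst (fst a))))"
    unfolding sum_subtractf[symmetric] sum_distrib_left
    by (intro sum.cong) (auto simp: tension_def algebra_simps)
  also have "\<dots> = tension \<theta> a"
    by (simp only: potential_decompose[OF src_in] potential_decompose[OF dst_in] tension_def)
  finally show ?thesis .
qed

text \<open>The derivative of \<open>arc_kernel p\<close> in the coordinate
  \<open>v\<close>.\<close>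

definition partial_kernel :: "complex ^ ('n \<times> bool) \<Rightarrow> 'v \<Rightarrow> ('v \<Rightarrow> real) \<Rightarrow> complex" where
  "partial_kernel p v \<tau> = - (\<Sum>a\<in>UNIV. p $ a *
      complex_of_real (2 * logistic (- tension \<tau> a) * tension (indicat_real {v}) a)) * arc_kernel p \<tau>"

lemma tension_fun_upd_deriv:
  "((\<lambda>t. tension (\<tau>(v := t)) a) has_real_derivative tension (indicat_real {v}) a) (at t)"
  by (subst tension_fun_upd) (auto intro!: derivative_eq_intros)

lemma arc_kernel_partial_deriv:
  "((\<lambda>t. arc_kernel p (\<tau>(v := t))) has_vector_derivative partial_kernel p v (\<tau>(v := t))) (at t)"
proof -
  have sp: "((\<lambda>t. softplus (tension (\<tau>(v := t)) a)) has_real_derivative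
      2 * logistic (- tension (\<tau>(v := t)) a) * tension (indicat_real {v}) a) (at t)" for a
    by (rule DERIV_chain2[OF softplus_deriv tension_fun_upd_deriv])
  have "((\<lambda>t. p $ a * complex_of_real (softplus (tension (\<tau>(v := t)) a))) has_vector_derivative
      p $ a * complex_of_real (2 * logistic (- tension (\<tau>(v := t)) a) * tension (indicat_real {v}) a))
      (at t)" for a
    by (intro has_vector_derivative_mult_right has_vector_derivative_of_real sp)
  then have "((\<lambda>t. - (\<Sum>a\<in>UNIV. p $ a * complex_of_real (softplus (tension (\<tau>(v := t)) a))))
      has_vector_derivative - (\<Sum>a\<in>UNIV. p $ a *
        complex_of_real (2 * logistic (- tension (\<tau>(v := t)) a) * tension (indicat_real {v}) a))) (at t)"
    by (intro has_vector_derivative_minus has_vector_derivative_sum)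
  from field_vector_diff_chain_at[OF this DERIV_exp] show ?thesis
    by (simp add: o_def arc_kernel_def[abs_def] partial_kernel_def)
qed

lemma isCont_partial_kernel: "isCont (\<lambda>t. partial_kernel p v (\<tau>(v := t))) t"
proof -
  have tension: "isCont (\<lambda>t. tension (\<tau>(v := t)) a) t" for a
    by (rule DERIV_isCont[OF tension_fun_upd_deriv])
  have "isCont logistic t" for t
    unfolding logistic_def[abs_def] using exp_gt_zero[of "2 * t"]
    by (intro continuous_intros) linarith
  note logistic = isCont_o2[OF continuous_minus[OF tension] this]
  have "isCont (\<lambda>t. arc_kernel p (\<tau>(v := t))) t"
    using arc_kernel_partial_deriv has_vector_derivative_continuous by blast
  then show ?thesis
    unfolding partial_kernel_def
    by (intro continuous_mult continuous_minus continuous_sum continuous_of_real logistic continuous_const)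
qed

lemma partial_kernel_measurable [measurable]: "partial_kernel p v \<in> borel_measurable vmeasure"
proof -
  have [measurable]: "(\<lambda>\<tau>. logistic (- tension \<tau> a)) \<in> borel_measurable vmeasure" for a
    unfolding logistic_minus by measurable
  show ?thesis unfolding partial_kernel_def[abs_def] by measurable
qed

lemma partial_kernel_bound:
  "norm (partial_kernel p v \<tau>) \<le>
    (\<Sum>a\<in>UNIV. norm (p $ a) * (2 * \<bar>tension (indicat_real {v}) a\<bar>)) * norm (arc_kernel p \<tau>)"
proof -
  have "norm (p $ a * complex_of_real (2 * logistic (- tension \<tau> a) * tension (indicat_real {v}) a)) \<le>
      norm (p $ a) * (2 * \<bar>tension (indicat_real {v}) a\<bar>)" for a
    using logistic_bounds[of "- tension \<tau> a"]
    by (auto simp: norm_mult abs_mult intro!: mult_left_mono mult_left_le_one_le)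
  then have "norm (- (\<Sum>a\<in>UNIV. p $ a *
      complex_of_real (2 * logistic (- tension \<tau> a) * tension (indicat_real {v}) a))) \<le>
      (\<Sum>a\<in>UNIV. norm (p $ a) * (2 * \<bar>tension (indicat_real {v}) a\<bar>))"
    unfolding norm_minus_cancel by (intro order_trans[OF norm_sum] sum_mono)
  from mult_right_mono[OF this norm_ge_zero] show ?thesis
    unfolding partial_kernel_def norm_mult[of "- _"] .
qed

lemma
  assumes "p \<in> halfspaces (\<lambda>_. 0)" "v \<in> V"
  shows integrable_partial_kernel: "integrable vmeasure (partial_kernel p v)"
    and integral_partial_kernel: "(LINT \<tau>|vmeasure. partial_kernel p v \<tau>) = 0"
proof -
  obtain \<eta> C where \<eta>: "\<eta> > 0" and C: "\<And>\<tau>. norm (arc_kernel p \<tau>) \<le> C * exp (- \<eta> * coord_norm V \<tau>)"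
    using arc_kernel_bound[OF assms(1)] by blast
  define K where "K = (\<Sum>a\<in>UNIV. norm (p $ a) * (2 * \<bar>tension (indicat_real {v}) a\<bar>))"
  have K: "K \<ge> 0" unfolding K_def by (intro sum_nonneg) auto
  have C0: "C \<ge> 0"
    using C[of "\<lambda>_. 0"] order_trans[OF norm_ge_zero] by (fastforce simp: coord_norm_def)
  \<comment> \<open>\<open>K + 1\<close> instead of \<open>K\<close> lets one constant dominate both
    the kernel and its derivative.\<close>
  define C' where "C' = (K + 1) * C"
  have "C * exp (- \<eta> * coord_norm V \<tau>) \<le> C' * exp (- \<eta> * coord_norm V \<tau>)" for \<tau>
    using K C0 mult_right_mono[of 1 "K + 1" C] by (intro mult_right_mono) (auto simp: C'_def)
  then have 1: "norm (arc_kernel p \<tau>) \<le> C' * exp (- \<eta> * coord_norm V \<tau>)" for \<tau>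
    using C order_trans by blast
  have 2: "norm (partial_kernel p v \<tau>) \<le> C' * exp (- \<eta> * coord_norm V \<tau>)" for \<tau>
  proof -
    have "norm (partial_kernel p v \<tau>) \<le> K * norm (arc_kernel p \<tau>)"
      unfolding K_def by (rule partial_kernel_bound)
    also have "\<dots> \<le> (K + 1) * (C * exp (- \<eta> * coord_norm V \<tau>))"
      using K C by (intro mult_mono) auto
    finally show ?thesis by (simp add: C'_def mult_ac)
  qed
  show "integrable vmeasure (partial_kernel p v)"
    by (rule integrable_exp_coord_norm_bound(1)[OF finite_V \<eta> partial_kernel_measurable 2])
  show "(LINT \<tau>|vmeasure. partial_kernel p v \<tau>) = 0"
    by (rule integral_partial_derivative_eq_0[OF finite_V assms(2) \<eta> arc_kernel_partial_deriv
          isCont_partial_kernel 1 2 partial_kernel_measurable])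
qed

lemma tension_flip: "tension \<tau> (flip a) = - tension \<tau> a"
  by (simp add: tension_def flip_def)

text \<open>An arc of positive \<theta>-tension is expanded by
  \<open>logistic (- t) = 1 - logistic t\<close> into a constant, which goes into
  \<open>crate\<close>, and a shift of that arc. An arc of negative tension is not expanded: its
  factor is already the logistic of the reversed arc, which has positive tension. Reindexing by
  \<open>flip\<close> collects both shifts, whence the coefficient
  \<open>p $ a + p $ flip a\<close>.\<close>

lemma directional_derivative_arc_kernel:
  "(\<Sum>v\<in>V. complex_of_real (\<theta> v) * partial_kernel p v \<tau>) =
    2 * ((\<Sum>a\<in>UNIV. complex_of_real (max 0 (tension \<theta> a)) * (p $ a + p $ flip a) * arc_kernel (p + axis a 1) \<tau>)
      - crate \<theta> p * arc_kernel p \<tau>)"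
proof -
  let ?m = "\<lambda>a. complex_of_real (max 0 (tension \<theta> a))"
  let ?l = "\<lambda>a. complex_of_real (logistic (tension \<tau> a))"
  have "(\<Sum>v\<in>V. complex_of_real (\<theta> v) * partial_kernel p v \<tau>) =
      - 2 * (\<Sum>v\<in>V. \<Sum>a\<in>UNIV. p $ a * complex_of_real (logistic (- tension \<tau> a)) *
        complex_of_real (\<theta> v * tension (indicat_real {v}) a)) * arc_kernel p \<tau>"
    by (simp add: partial_kernel_def sum_distrib_left sum_distrib_right mult_ac flip: sum_negf)
  also have "(\<Sum>v\<in>V. \<Sum>a\<in>UNIV. p $ a * complex_of_real (logistic (- tension \<tau> a)) *
        complex_of_real (\<theta> v * tension (indicat_real {v}) a)) =
      (\<Sum>a\<in>UNIV. p $ a * complex_of_real (logistic (- tension \<tau> a)) *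
        complex_of_real (\<Sum>v\<in>V. \<theta> v * tension (indicat_real {v}) a))"
    by (subst sum.swap) (simp add: sum_distrib_left)
  also have "\<dots> = (\<Sum>a\<in>UNIV. p $ a * complex_of_real (logistic (- tension \<tau> a)) * complex_of_real (tension \<theta> a))"
    by (simp add: tension_decompose)
  also have "\<dots> = (\<Sum>a\<in>UNIV. ?m a * p $ a - ?m a * p $ a * ?l a - ?m (flip a) * p $ a * ?l (flip a))"
  proof (intro sum.cong refl)
    fix a :: "'n \<times> bool"
    have m: "?m a - ?m (flip a) = complex_of_real (tension \<theta> a)"
      by (simp add: tension_flip max_def)
    have "?m a * p $ a - ?m a * p $ a * ?l a - ?m (flip a) * p $ a * ?l (flip a) =
        p $ a * complex_of_real (logistic (- tension \<tau> a)) * (?m a - ?m (flip a))"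
      by (simp add: tension_flip logistic_minus algebra_simps)
    then show "p $ a * complex_of_real (logistic (- tension \<tau> a)) * complex_of_real (tension \<theta> a) =
        ?m a * p $ a - ?m a * p $ a * ?l a - ?m (flip a) * p $ a * ?l (flip a)"
      by (simp only: m)
  qed
  also have "\<dots> = crate \<theta> p - (\<Sum>a\<in>UNIV. ?m a * p $ a * ?l a) -
      (\<Sum>a\<in>UNIV. ?m (flip a) * p $ a * ?l (flip a))"
    by (simp add: sum_subtractf crate_def)
  also have "(\<Sum>a\<in>UNIV. ?m (flip a) * p $ a * ?l (flip a)) = (\<Sum>a\<in>UNIV. ?m a * p $ flip a * ?l a)"
    by (rule sum.reindex_bij_witness[of _ flip flip]) (auto simp: flip_def)
  finally have "(\<Sum>v\<in>V. complex_of_real (\<theta> v) * partial_kernel p v \<tau>) =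
      - 2 * (crate \<theta> p - ((\<Sum>a\<in>UNIV. ?m a * p $ a * ?l a) + (\<Sum>a\<in>UNIV. ?m a * p $ flip a * ?l a))) *
        arc_kernel p \<tau>"
    by simp
  also have "(\<Sum>a\<in>UNIV. ?m a * p $ a * ?l a) + (\<Sum>a\<in>UNIV. ?m a * p $ flip a * ?l a) =
      (\<Sum>a\<in>UNIV. ?m a * (p $ a + p $ flip a) * ?l a)"
    by (simp add: distrib_left distrib_right sum.distrib)
  also have "- 2 * (crate \<theta> p - (\<Sum>a\<in>UNIV. ?m a * (p $ a + p $ flip a) * ?l a)) * arc_kernel p \<tau> =
      2 * ((\<Sum>a\<in>UNIV. ?m a * (p $ a + p $ flip a) * ?l a) * arc_kernel p \<tau> - crate \<theta> p * arc_kernel p \<tau>)"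
    by (simp add: left_diff_distrib)
  also have "(\<Sum>a\<in>UNIV. ?m a * (p $ a + p $ flip a) * ?l a) * arc_kernel p \<tau> =
      (\<Sum>a\<in>UNIV. ?m a * (p $ a + p $ flip a) * arc_kernel (p + axis a 1) \<tau>)"
    unfolding sum_distrib_right
    by (intro sum.cong) (simp_all add: arc_kernel_add arc_kernel_axis)
  finally show ?thesis .
qed

lemma integrable_shifted_arc_kernel:
  assumes "p \<in> halfspaces (\<lambda>_. 0)"
  shows "integrable vmeasure (arc_kernel (p + axis a 1))"
proof (rule Bochner_Integration.integrable_bound[OF integrable_arc_kernel[OF assms] measurable_arc_kernel])
  show "AE \<tau> in vmeasure. norm (arc_kernel (p + axis a 1) \<tau>) \<le> norm (arc_kernel p \<tau>)"
    using logistic_bounds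
    by (intro AE_I2) (auto simp: arc_kernel_add arc_kernel_axis norm_mult intro!: mult_left_le)
qed

theorem arc_integral_recursion:
  assumes p: "p \<in> halfspaces (\<lambda>_. 0)"
  shows "crate \<theta> p * arc_integral p = (\<Sum>a\<in>UNIV. complex_of_real (max 0 (tension \<theta> a)) *
    (p $ a + p $ flip a) * arc_integral (p + axis a 1))"
proof -
  have "0 = (LINT \<tau>|vmeasure. (\<Sum>v\<in>V. complex_of_real (\<theta> v) * partial_kernel p v \<tau>))"
    using integrable_partial_kernel[OF p] integral_partial_kernel[OF p]
    by (subst Bochner_Integration.integral_sum) auto
  also have "\<dots> = 2 * ((\<Sum>a\<in>UNIV. complex_of_real (max 0 (tension \<theta> a)) * (p $ a + p $ flip a) *
      arc_integral (p + axis a 1)) - crate \<theta> p * arc_integral p)"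
    unfolding directional_derivative_arc_kernel arc_integral_def
    using integrable_shifted_arc_kernel[OF p] integrable_arc_kernel[OF p]
    by (simp add: Bochner_Integration.integral_diff Bochner_Integration.integral_sum
        Bochner_Integration.integrable_sum)
  finally show ?thesis by simp
qed

end

section \<open>Analytic continuation\<close>

context rooted_graph
begin

text \<open>The reciprocal Gamma function is entire with zeros exactly at the nonpositive integers,
  so this product records every possible pole without introducing any.\<close>

definition pole_factor :: "complex ^ ('n \<times> bool) \<Rightarrow> complex" where
  "pole_factor p = (\<Prod>i\<in>rays. rGamma (crate (ray i) p))"

definition regularized :: "complex ^ ('n \<times> bool) \<Rightarrow> complex" where
  "regularized p = arc_integral p * pole_factor p"

lemma cdiff_crate: "cdiff (crate \<theta>) p"
  unfolding crate_def[abs_def] by (intro cdiff_sum cdiff_mult cdiff_const cdiff_nth)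

lemma cdiff_pole_factor: "cdiff pole_factor p"
  unfolding pole_factor_def[abs_def]
  by (intro cdiff_prod cdiff_compose_field[of rGamma] field_differentiable_rGamma cdiff_crate)

lemma crate_add: "crate \<theta> (p + q) = crate \<theta> p + crate \<theta> q"
  by (simp add: crate_def distrib_left sum.distrib)

lemma crate_axis: "crate \<theta> (axis a 1) = complex_of_real (max 0 (tension \<theta> a))"
proof -
  have "crate \<theta> (axis a 1) =
      (\<Sum>b\<in>UNIV. if b = a then complex_of_real (max 0 (tension \<theta> b)) else 0)"
    unfolding crate_def by (intro sum.cong) (auto simp: axis_def)
  then show ?thesis by simp
qed

text \<open>Indicator potentials have tensions 0, 1 or -1, so one exponent shift raises each ray
  rate by 0 or exactly 1. This matches the unit step in the functional equation of
  \<open>rGamma\<close>.\<close>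

lemma crate_ray_shift:
  "crate (ray i) (p + axis a 1) = crate (ray i) p + (if tension (ray i) a > 0 then 1 else 0)"
  by (simp add: crate_add crate_axis max_tension_ray)

text \<open>The equation \<open>z * rGamma (z + 1) = rGamma z\<close> is applied to every ray whose
  rate rises. The factor of ray \<open>i\<close> is kept apart because it has to cancel the rate on
  the left of \<open>arc_integral_recursion\<close>.\<close>

lemma pole_factor_shift:
  assumes "i \<in> rays" "tension (ray i) a > 0"
  shows "crate (ray i) p * ((\<Prod>j\<in>rays - {i}. if tension (ray j) a > 0 then crate (ray j) p else 1) *
    pole_factor (p + axis a 1)) = pole_factor p"
proof -
  have "(if tension (ray j) a > 0 then crate (ray j) p else 1) * rGamma (crate (ray j) (p + axis a 1)) =
      rGamma (crate (ray j) p)" for j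
    by (simp add: crate_ray_shift rGamma_plus1)
  then have "(\<Prod>j\<in>rays - {i}. if tension (ray j) a > 0 then crate (ray j) p else 1) *
      (\<Prod>j\<in>rays - {i}. rGamma (crate (ray j) (p + axis a 1))) =
      (\<Prod>j\<in>rays - {i}. rGamma (crate (ray j) p))"
    by (simp flip: prod.distrib)
  moreover have "crate (ray i) p * rGamma (crate (ray i) (p + axis a 1)) = rGamma (crate (ray i) p)"
    using assms by (simp add: crate_ray_shift rGamma_plus1)
  moreover have "c * (Q * (r' * R')) = r * R" if "Q * R' = R" "c * r' = r" for c Q r' R' r R :: complex
    unfolding that[symmetric] by (simp only: mult_ac)
  ultimately show ?thesis
    unfolding pole_factor_def prod.remove[OF finite_rays assms(1)] by blast
qed

text \<open>After the rate of ray \<open>i\<close> is cancelled, which is legitimate where it has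
  positive real part, all coefficients are polynomials in \<open>p\<close>. The right-hand side thus
  makes sense wherever the shifted values do.\<close>

lemma regularized_recursion:
  assumes p: "p \<in> halfspaces (\<lambda>_. 0)" and i: "i \<in> rays"
  shows "regularized p = (\<Sum>a | tension (ray i) a > 0. (p $ a + p $ flip a) *
    (\<Prod>j\<in>rays - {i}. if tension (ray j) a > 0 then crate (ray j) p else 1) *
    regularized (p + axis a 1))"
proof -
  have c: "crate (ray i) p \<noteq> 0"
    using p i by (force simp: halfspaces_def)
  have "crate (ray i) p * regularized p = (\<Sum>a\<in>UNIV. complex_of_real (max 0 (tension (ray i) a)) *
      (p $ a + p $ flip a) * arc_integral (p + axis a 1)) * pole_factor p"
    using arc_integral_recursion[OF p, of "ray i"] by (simp add: regularized_def)
  also have "(\<Sum>a\<in>UNIV. complex_of_real (max 0 (tension (ray i) a)) *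
      (p $ a + p $ flip a) * arc_integral (p + axis a 1)) =
      (\<Sum>a | tension (ray i) a > 0. (p $ a + p $ flip a) * arc_integral (p + axis a 1))"
    by (rule sum.mono_neutral_cong_right) (auto simp: max_tension_ray)
  also have "\<dots> * pole_factor p = (\<Sum>a | tension (ray i) a > 0. crate (ray i) p * ((p $ a + p $ flip a) *
      (\<Prod>j\<in>rays - {i}. if tension (ray j) a > 0 then crate (ray j) p else 1) *
      regularized (p + axis a 1)))"
    unfolding sum_distrib_right
  proof (intro sum.cong refl)
    fix a assume "a \<in> {a. tension (ray i) a > 0}"
    then have a: "tension (ray i) a > 0" by simp
    show "(p $ a + p $ flip a) * arc_integral (p + axis a 1) * pole_factor p =
        crate (ray i) p * ((p $ a + p $ flip a) *
        (\<Prod>j\<in>rays - {i}. if tension (ray j) a > 0 then crate (ray j) p else 1) *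
        regularized (p + axis a 1))"
      unfolding pole_factor_shift[OF i a, of p, symmetric] regularized_def by (simp only: mult_ac)
  qed
  also have "\<dots> = crate (ray i) p * (\<Sum>a | tension (ray i) a > 0. (p $ a + p $ flip a) *
      (\<Prod>j\<in>rays - {i}. if tension (ray j) a > 0 then crate (ray j) p else 1) *
      regularized (p + axis a 1))"
    by (simp add: sum_distrib_left)
  finally show ?thesis using c by simp
qed

section \<open>Continuation through growing half-space domains\<close>

lemma open_halfspaces: "open (halfspaces M)"
proof -
  have "continuous_on UNIV (\<lambda>p. Re (crate (ray i) p))" for i
    by (intro continuous_on_Re continuous_at_imp_continuous_on ballI cdiff_isCont cdiff_crate)
  then have "open {p. - real (M i) < Re (crate (ray i) p)}" for i
    by (intro open_Collect_less) (auto intro: continuous_intros)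
  then have "open (\<Inter>i\<in>rays. {p. - real (M i) < Re (crate (ray i) p)})"
    using finite_rays by (intro open_INT) auto
  moreover have "(\<Inter>i\<in>rays. {p. - real (M i) < Re (crate (ray i) p)}) = halfspaces M"
    by (auto simp: halfspaces_def)
  ultimately show ?thesis by simp
qed

lemma crate_scaleR: "crate \<theta> (c *\<^sub>R p) = c *\<^sub>R crate \<theta> p"
  by (simp add: crate_def scaleR_sum_right)

lemma convex_halfspaces: "convex (halfspaces M)"
proof (rule convexI)
  fix p q :: "complex ^ ('n \<times> bool)" and u v :: real
  assume *: "p \<in> halfspaces M" "q \<in> halfspaces M" "0 \<le> u" "0 \<le> v" "u + v = 1"
  show "u *\<^sub>R p + v *\<^sub>R q \<in> halfspaces M"
    unfolding halfspaces_def
  proof safe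
    fix S s assume i: "(S, s) \<in> rays"
    let ?H = "{- real (M (S, s))<..}"
    have "convex ?H" by (rule convex_real_interval)
    moreover have "Re (crate (ray (S, s)) p) \<in> ?H" "Re (crate (ray (S, s)) q) \<in> ?H"
      using * i by (auto simp: halfspaces_def)
    ultimately have "u *\<^sub>R Re (crate (ray (S, s)) p) + v *\<^sub>R Re (crate (ray (S, s)) q) \<in> ?H"
      using * by (intro convexD) auto
    then show "- real (M (S, s)) < Re (crate (ray (S, s)) (u *\<^sub>R p + v *\<^sub>R q))"
      by (simp add: crate_add crate_scaleR)
  qed
qed

lemma halfspaces_mono: "(\<And>i. i \<in> rays \<Longrightarrow> M i \<le> N i) \<Longrightarrow> halfspaces M \<subseteq> halfspaces N"
  by (force simp: halfspaces_def)

lemma halfspaces_pos: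
  assumes "\<And>a. Re (p $ a) > 0"
  shows "p \<in> halfspaces (\<lambda>_. 0)"
  using rate_ray_pos[OF _ assms] by (auto simp: halfspaces_def Re_crate)

text \<open>Induction on the total number of unit steps. To relax the bound of ray \<open>i\<close>
  by one, the right-hand side of its recursion serves as the definition: every shift occurring there
  raises that rate by one and lowers none, so it lands in the smaller domain. On the domain of
  convergence, which is stable under all shifts, the recursion itself shows agreement.\<close>

lemma extension_to_halfspaces:
  "\<exists>g. (\<forall>p\<in>halfspaces M. cdiff g p) \<and> (\<forall>p\<in>halfspaces (\<lambda>_. 0). g p = regularized p)"
proof (induction "\<Sum>i\<in>rays. M i" arbitrary: M)
  case 0
  then have "M i = 0" if "i \<in> rays" for i using that finite_rays by simp
  then have "halfspaces M = halfspaces (\<lambda>_. 0)" by (auto simp: halfspaces_def)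
  moreover have "cdiff regularized p" if "p \<in> halfspaces (\<lambda>_. 0)" for p
    unfolding regularized_def[abs_def]
    using cdiff_mult[OF cdiff_arc_integral[OF that] cdiff_pole_factor] .
  ultimately show ?case by blast
next
  case (Suc m)
  then have "(\<Sum>i\<in>rays. M i) \<noteq> 0" by simp
  then obtain i where i: "i \<in> rays" "M i \<noteq> 0" by (meson sum.neutral)
  define M' where "M' = M(i := M i - 1)"
  have "(\<Sum>j\<in>rays. M j) = M i + (\<Sum>j\<in>rays - {i}. M j)"
    "(\<Sum>j\<in>rays. M' j) = M' i + (\<Sum>j\<in>rays - {i}. M' j)"
    using sum.remove[OF finite_rays i(1)] by blast+
  moreover have "(\<Sum>j\<in>rays - {i}. M' j) = (\<Sum>j\<in>rays - {i}. M j)"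
    by (intro sum.cong) (auto simp: M'_def)
  ultimately have "m = (\<Sum>j\<in>rays. M' j)" using Suc.hyps(2) i(2) by (simp add: M'_def)
  from Suc.hyps(1)[OF this] obtain g where g: "\<And>p. p \<in> halfspaces M' \<Longrightarrow> cdiff g p"
    "\<And>p. p \<in> halfspaces (\<lambda>_. 0) \<Longrightarrow> g p = regularized p" by blast
  have shift: "p + axis a 1 \<in> halfspaces M'" if "p \<in> halfspaces M" "tension (ray i) a > 0" for p a
    using that i(2) by (force simp: halfspaces_def M'_def crate_ray_shift)
  have shift0: "p + axis a 1 \<in> halfspaces (\<lambda>_. 0)" if "p \<in> halfspaces (\<lambda>_. 0)" for p a
    using that by (force simp: halfspaces_def crate_ray_shift)
  define f where "f = (\<lambda>p. \<Sum>a | tension (ray i) a > 0. (p $ a + p $ flip a) *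
    (\<Prod>j\<in>rays - {i}. if tension (ray j) a > 0 then crate (ray j) p else 1) * g (p + axis a 1))"
  have "cdiff f p" if "p \<in> halfspaces M" for p
  proof -
    have "cdiff (\<lambda>p. if tension (ray j) a > 0 then crate (ray j) p else 1) p" for j a
      by (cases "tension (ray j) a > 0") (simp_all add: cdiff_crate)
    then show ?thesis
      unfolding f_def using g(1)[OF shift[OF that]]
      by (intro cdiff_sum cdiff_mult cdiff_add cdiff_nth cdiff_prod cdiff_shift) auto
  qed
  moreover have "f p = regularized p" if "p \<in> halfspaces (\<lambda>_. 0)" for p
    unfolding f_def using g(2)[OF shift0[OF that]] regularized_recursion[OF that i(1)] by simp
  ultimately show ?case by blast
qed

text \<open>Domains with a constant bound \<open>N\<close> exhaust the space because there are
  finitely many rays. They are convex and share the nonempty domain of convergence, so the identity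
  theorem makes the extensions compatible; \<open>LEAST\<close> merely selects one.\<close>

lemma regularized_entire:
  "\<exists>\<Phi>. (\<forall>p. cdiff \<Phi> p) \<and> (\<forall>p\<in>halfspaces (\<lambda>_. 0). \<Phi> p = regularized p)"
proof -
  let ?H = "\<lambda>N. halfspaces (\<lambda>_. N)"
  have "\<forall>N. \<exists>g. (\<forall>p\<in>?H N. cdiff g p) \<and> (\<forall>p\<in>?H 0. g p = regularized p)"
    using extension_to_halfspaces by blast
  then obtain g where g: "\<And>N p. p \<in> ?H N \<Longrightarrow> cdiff (g N) p"
    "\<And>N p. p \<in> ?H 0 \<Longrightarrow> g N p = regularized p"
    by metis
  have mono: "?H K \<subseteq> ?H N" if "K \<le> N" for K N using that by (intro halfspaces_mono) auto
  have pos: "(\<chi> a. 1) \<in> ?H 0" by (rule halfspaces_pos) simp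
  have agree: "g K p = g N p" if "K \<le> N" "p \<in> ?H K" for K N p
  proof -
    have "g K p - g N p = 0"
    proof (rule identity_Cn[where f = "\<lambda>p. g K p - g N p",
          OF open_halfspaces convex_halfspaces _ open_halfspaces pos mono _ that(2)])
      show "cdiff (\<lambda>p. g K p - g N p) q" if "q \<in> ?H K" for q
        using that g(1) mono[OF \<open>K \<le> N\<close>] by (intro cdiff_diff) auto
    qed (simp_all add: g(2))
    then show ?thesis by simp
  qed
  have cover: "\<exists>N. p \<in> ?H N" for p
  proof -
    obtain N where N: "(\<Sum>i\<in>rays. \<bar>Re (crate (ray i) p)\<bar>) < real N"
      using reals_Archimedean2 by blast
    have "\<bar>Re (crate (ray i) p)\<bar> \<le> (\<Sum>i\<in>rays. \<bar>Re (crate (ray i) p)\<bar>)" if "i \<in> rays" for i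
      using that finite_rays by (intro member_le_sum) auto
    then have "p \<in> ?H N" using N by (force simp: halfspaces_def)
    then show ?thesis by blast
  qed
  define \<Phi> where "\<Phi> = (\<lambda>p. g (LEAST N. p \<in> ?H N) p)"
  have eq: "\<Phi> p = g N p" if "p \<in> ?H N" for p N
  proof -
    let ?P = "\<lambda>N. p \<in> ?H N"
    have "(LEAST N. ?P N) \<le> N" "?P (LEAST N. ?P N)"
      using that by (rule Least_le, rule LeastI)
    then show ?thesis unfolding \<Phi>_def by (rule agree)
  qed
  have "cdiff \<Phi> p" for p
  proof -
    obtain N where N: "p \<in> ?H N" using cover by blast
    show ?thesis
      by (rule cdiff_transform[OF g(1)[OF N] open_halfspaces N]) (simp add: eq)
  qed
  moreover have "\<Phi> p = regularized p" if "p \<in> ?H 0" for p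
    using eq[OF that] g(2)[OF that] by simp
  ultimately show ?thesis by blast
qed

lemma pole_factor_nonzero: "p \<in> halfspaces (\<lambda>_. 0) \<Longrightarrow> pole_factor p \<noteq> 0"
  using finite_rays
  by (force simp: pole_factor_def halfspaces_def rGamma_eq_zero_iff elim: nonpos_Ints_cases')

end

section \<open>The zonotopal integral\<close>

lemma connected_induce_insert:
  assumes conn: "Digraph_Component.connected (G \<restriction> C)" and e: "e \<in> arcs G"
    and ends: "{tail G e, head G e} = {u, v}" "u \<in> C"
  shows "Digraph_Component.connected (G \<restriction> insert v C)"
proof -
  let ?H = "mk_symmetric (G \<restriction> insert v C)"
  have wf: "wf_digraph (G \<restriction> S)" for S
    by unfold_locales auto
  interpret C: wf_digraph "G \<restriction> C" by (rule wf)
  interpret I: wf_digraph "G \<restriction> insert v C" by (rule wf)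
  interpret H: pair_wf_digraph ?H by (rule I.wellformed_mk_symmetric)
  have sub: "subgraph (mk_symmetric (G \<restriction> C)) ?H"
    using C.wf_digraph_axioms I.wf_digraph_axioms
    by (intro subgraph_mk_symmetric) (auto simp: subgraph_def compatible_def)
  have C_reach: "x \<rightarrow>\<^sup>*\<^bsub>with_proj ?H\<^esub> y" if "x \<in> C" "y \<in> C" for x y
  proof -
    have "x \<rightarrow>\<^sup>*\<^bsub>with_proj (mk_symmetric (G \<restriction> C))\<^esub> y"
      using conn that by (auto simp: Digraph_Component.connected_def strongly_connected_def)
    then show ?thesis using sub by (rule pre_digraph.reachable_mono)
  qed
  have "(u, v) \<in> parcs ?H" "(v, u) \<in> parcs ?H"
    using e ends by (auto simp: parcs_mk_symmetric doubleton_eq_iff)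
  then have uv: "u \<rightarrow>\<^sup>*\<^bsub>with_proj ?H\<^esub> v" "v \<rightarrow>\<^sup>*\<^bsub>with_proj ?H\<^esub> u"
    by auto
  \<comment> \<open>Reachability is routed through \<open>u\<close>: every vertex reaches it and is
    reached from it.\<close>
  have hub: "x \<rightarrow>\<^sup>*\<^bsub>with_proj ?H\<^esub> u \<and> u \<rightarrow>\<^sup>*\<^bsub>with_proj ?H\<^esub> x" if "x \<in> insert v C" for x
    using that C_reach[of x u] C_reach[of u x] uv ends(2) by blast
  have "x \<rightarrow>\<^sup>*\<^bsub>with_proj ?H\<^esub> y" if "x \<in> insert v C" "y \<in> insert v C" for x y
    using hub[OF that(1), THEN conjunct1] hub[OF that(2), THEN conjunct2]
    by (rule H.reachable_trans)
  then show ?thesis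
    by (simp add: Digraph_Component.connected_def strongly_connected_def)
qed

lemma connected_induce_singleton: "Digraph_Component.connected (G \<restriction> {v})"
proof -
  interpret wf_digraph "G \<restriction> {v}" by unfold_locales auto
  interpret H: pair_wf_digraph "mk_symmetric (G \<restriction> {v})" by (rule wellformed_mk_symmetric)
  show ?thesis
    by (auto simp: Digraph_Component.connected_def strongly_connected_def)
qed

text \<open>A connected subset of maximal cardinality works, since an edge to the rest of
  \<open>S\<close> would allow it to be enlarged.\<close>

lemma exists_connected_component:
  assumes "finite S" "S \<noteq> {}"
  shows "\<exists>C\<subseteq>S. C \<noteq> {} \<and> Digraph_Component.connected (G \<restriction> C) \<and>
    (\<forall>e\<in>arcs G. \<forall>u\<in>C. \<forall>v\<in>S - C. {tail G e, head G e} \<noteq> {u, v})"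
proof -
  let ?P = "\<lambda>C. C \<subseteq> S \<and> C \<noteq> {} \<and> Digraph_Component.connected (G \<restriction> C)"
  obtain x where "x \<in> S" using assms(2) by blast
  then have "?P {x}" using connected_induce_singleton by auto
  moreover have "\<forall>C. ?P C \<longrightarrow> card C < Suc (card S)"
    using assms(1) by (auto simp: less_Suc_eq_le intro: card_mono)
  ultimately have "\<exists>C. ?P C \<and> (\<forall>D. ?P D \<longrightarrow> card D \<le> card C)"
    by (rule Lattices_Big.ex_has_greatest_nat)
  then obtain C where C: "?P C" "\<forall>D. ?P D \<longrightarrow> card D \<le> card C"
    by (elim exE) (rule that, erule conjunct1, erule conjunct2)
  have "{tail G e, head G e} \<noteq> {u, v}" if "e \<in> arcs G" "u \<in> C" "v \<in> S - C" for e u v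
  proof
    assume "{tail G e, head G e} = {u, v}"
    then have "?P (insert v C)" using connected_induce_insert[OF _ that(1)] C(1) that by blast
    then have "card (insert v C) \<le> card C" by (rule C(2)[rule_format])
    moreover have "finite C" using C(1) assms(1) finite_subset by blast
    ultimately show False using that(3) by simp
  qed
  then show ?thesis using C(1) by blast
qed

section \<open>Specialization to the energies\<close>

definition spread :: "real \<Rightarrow> complex ^ 'n \<Rightarrow> complex ^ ('n \<times> bool)" where
  "spread \<alpha> z = (\<chi> a. complex_of_real (\<alpha> / 2) * z $ fst a)"

lemma cdiff_compose_spread:
  assumes "\<And>p. cdiff f p"
  shows "cdiff (\<lambda>z. f (spread \<alpha> z)) z"
proof (rule cdiff_compose_affine[OF assms])
  have "bounded_linear (spread \<alpha>)"
    by (rule linear_conv_bounded_linear[THEN iffD1])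
      (auto intro!: linearI simp: spread_def vec_eq_iff algebra_simps)
  then show "(spread \<alpha> has_derivative spread \<alpha>) (at z)"
    by (rule bounded_linear_imp_has_derivative)
qed (simp add: spread_def vec_eq_iff)

locale labelled_graph =
  fixes G :: "('v, 'e) pre_digraph" and coord :: "'v + 'e \<Rightarrow> 'n :: finite"
  assumes fin: "fin_digraph G" and nonempty: "verts G \<noteq> {}"
    and coord: "bij_betw coord (verts G <+> arcs G) UNIV"
begin

definition label :: "'n \<Rightarrow> 'v + 'e" where
  "label = inv_into (verts G <+> arcs G) coord"

definition edge_src :: "'n \<Rightarrow> 'v option" where
  "edge_src k = (case label k of Inl v \<Rightarrow> Some v | Inr e \<Rightarrow> Some (tail G e))"

definition edge_dst :: "'n \<Rightarrow> 'v option" where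
  "edge_dst k = (case label k of Inl v \<Rightarrow> None | Inr e \<Rightarrow> Some (head G e))"

definition connected_sets :: "'v set set" where
  "connected_sets = {S. S \<subseteq> verts G \<and> S \<noteq> {} \<and> Digraph_Component.connected (G \<restriction> S)}"

lemma label_coord: "x \<in> verts G <+> arcs G \<Longrightarrow> label (coord x) = x"
  unfolding label_def using coord by (intro inv_into_f_f) (auto simp: bij_betw_def)

lemma label_in: "label k \<in> verts G <+> arcs G"
  unfolding label_def using coord by (intro inv_into_into) (auto simp: bij_betw_def)

lemma label_cases:
  obtains v where "label k = Inl v" "v \<in> verts G" | e where "label k = Inr e" "e \<in> arcs G"
  using label_in[of k] by (elim PlusE) auto

sublocale fin_digraph G by (rule fin)

sublocale rooted_graph "verts G" edge_src edge_dst connected_sets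
proof unfold_locales
  show "finite (verts G)" by simp
  show "verts G \<noteq> {}" by (rule nonempty)
  show "edge_src k \<in> insert None (Some ` verts G)" "edge_dst k \<in> insert None (Some ` verts G)" for k
    by (rule label_cases[of k]; simp add: edge_src_def edge_dst_def)+
  show "\<exists>k. edge_src k = Some v \<and> edge_dst k = None" if "v \<in> verts G" for v
    using that by (intro exI[of _ "coord (Inl v)"]) (simp add: edge_src_def edge_dst_def label_coord[OF InlI])
  show "S \<subseteq> verts G \<and> S \<noteq> {}" if "S \<in> connected_sets" for S
    using that by (simp add: connected_sets_def)
  fix S assume S: "S \<subseteq> verts G" "S \<noteq> {}"
  then have "finite S" using finite_verts finite_subset by blast
  from exists_connected_component[OF this S(2), of G] obtain C
    where C: "C \<subseteq> S" "C \<noteq> {}" "Digraph_Component.connected (G \<restriction> C)"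
      "\<And>e u v. e \<in> arcs G \<Longrightarrow> u \<in> C \<Longrightarrow> v \<in> S - C \<Longrightarrow> {tail G e, head G e} \<noteq> {u, v}"
    by blast
  have "edge_dst k \<notin> Some ` (S - C)" if "edge_src k \<in> Some ` C" for k
    using that C(4) by (cases k rule: label_cases) (auto simp: edge_src_def edge_dst_def)
  moreover have "edge_src k \<notin> Some ` (S - C)" if "edge_dst k \<in> Some ` C" for k
    using that C(4)[of _ "head G _" "tail G _"]
    by (cases k rule: label_cases) (auto simp: edge_src_def edge_dst_def insert_commute)
  moreover have "C \<in> connected_sets" using C(1-3) S(1) by (auto simp: connected_sets_def)
  ultimately show "\<exists>C\<in>connected_sets. C \<subseteq> S \<and>
      (\<forall>k. edge_src k \<in> Some ` C \<longrightarrow> edge_dst k \<notin> Some ` (S - C)) \<and>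
      (\<forall>k. edge_dst k \<in> Some ` C \<longrightarrow> edge_src k \<notin> Some ` (S - C))"
    using C(1) by blast
qed

lemma tension_coord:
  "v \<in> verts G \<Longrightarrow> tension \<tau> (coord (Inl v), True) = \<tau> v"
  "e \<in> arcs G \<Longrightarrow> tension \<tau> (coord (Inr e), True) = \<tau> (tail G e) - \<tau> (head G e)"
  by (simp_all add: tension_def edge_src_def edge_dst_def label_coord InlI InrI)

lemma tension_False: "tension \<tau> (k, False) = - tension \<tau> (k, True)"
  by (simp add: tension_def)

lemma sum_UNIV_arcs: "(\<Sum>a\<in>(UNIV :: ('n \<times> bool) set). f a) = (\<Sum>k\<in>UNIV. f (k, True) + f (k, False))"
proof -
  have "(\<Sum>a\<in>UNIV. f a) = (\<Sum>k\<in>UNIV. \<Sum>b\<in>UNIV. f (k, b))"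
    unfolding sum.cartesian_product UNIV_Times_UNIV by simp
  then show ?thesis by (simp add: UNIV_bool add.commute)
qed

lemma sum_coord:
  fixes f :: "'n \<Rightarrow> complex"
  shows "(\<Sum>k\<in>UNIV. f k) = (\<Sum>v\<in>verts G. f (coord (Inl v))) + (\<Sum>e\<in>arcs G. f (coord (Inr e)))"
  by (simp add: sum.reindex_bij_betw[OF coord, symmetric] sum.Plus)

lemma prod_coord:
  fixes f :: "'n \<Rightarrow> real"
  shows "(\<Prod>k\<in>UNIV. f k) = (\<Prod>v\<in>verts G. f (coord (Inl v))) * (\<Prod>e\<in>arcs G. f (coord (Inr e)))"
  by (simp add: prod.reindex_bij_betw[OF coord, symmetric] prod.Plus)

lemma rays_connected: "(S, s) \<in> rays \<Longrightarrow> S \<in> connected_sets"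
  by (simp add: rays_def)

text \<open>The two orientations of an edge together contribute the absolute tension, which is 1
  exactly on root edges at \<open>S\<close> and on boundary edges of \<open>S\<close>. The sign
  \<open>s\<close> disappears, so both rays over \<open>S\<close> give the same hyperplanes.\<close>

lemma crate_ray_spread:
  assumes "(S, s) \<in> rays"
  shows "crate (ray (S, s)) (spread \<alpha> z) = complex_of_real (\<alpha> / 2) *
    energy_sum G (\<lambda>v. z $ coord (Inl v)) (\<lambda>e. z $ coord (Inr e)) S"
proof -
  have S: "S \<subseteq> verts G" using rays_connected[OF assms] by (simp add: connected_sets_def)
  have "crate (ray (S, s)) (spread \<alpha> z) = (\<Sum>k\<in>UNIV. complex_of_real (\<alpha> / 2) *
      (complex_of_real \<bar>tension (ray (S, s)) (k, True)\<bar> * z $ k))"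
    unfolding crate_def sum_UNIV_arcs
    by (intro sum.cong) (auto simp: spread_def tension_False max_def algebra_simps)
  also have "\<dots> = complex_of_real (\<alpha> / 2) *
      (\<Sum>k\<in>UNIV. complex_of_real \<bar>tension (ray (S, s)) (k, True)\<bar> * z $ k)"
    by (simp add: sum_distrib_left)
  also have "(\<Sum>k\<in>UNIV. complex_of_real \<bar>tension (ray (S, s)) (k, True)\<bar> * z $ k) =
      (\<Sum>v\<in>verts G. if v \<in> S then z $ coord (Inl v) else 0) +
      (\<Sum>e\<in>arcs G. if (tail G e \<in> S) \<noteq> (head G e \<in> S) then z $ coord (Inr e) else 0)"
    unfolding sum_coord
    by (intro arg_cong2[where f = "(+)"] sum.cong) (auto simp: tension_coord ray_def indicator_def)
  also have "\<dots> = energy_sum G (\<lambda>v. z $ coord (Inl v)) (\<lambda>e. z $ coord (Inr e)) S"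
  proof -
    have "{v \<in> verts G. v \<in> S} = S" using S by blast
    then show ?thesis by (simp add: energy_sum_def edge_boundary_def sum.If_cases Int_def)
  qed
  finally show ?thesis .
qed

text \<open>The integrands agree pointwise, each orientation receiving half of the exponent by
  \<open>ln_2_cosh\<close>; hence no convergence or sign condition on \<open>w\<close>
  enters.\<close>

lemma zono_integral_eq:
  "complex_of_real (zono_integral G \<alpha> (\<lambda>v. w $ coord (Inl v)) (\<lambda>e. w $ coord (Inr e))) =
    complex_of_real (\<alpha> ^ card (verts G)) * arc_integral (spread \<alpha> (cvec w))"
proof -
  have "complex_of_real ((\<Prod>v\<in>verts G. (2 * cosh (\<tau> v)) powr (- \<alpha> * w $ coord (Inl v))) *
      (\<Prod>e\<in>arcs G. (2 * cosh (\<tau> (tail G e) - \<tau> (head G e))) powr (- \<alpha> * w $ coord (Inr e)))) =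
      arc_kernel (spread \<alpha> (cvec w)) \<tau>" for \<tau>
  proof -
    have "(\<Prod>v\<in>verts G. (2 * cosh (\<tau> v)) powr (- \<alpha> * w $ coord (Inl v))) *
        (\<Prod>e\<in>arcs G. (2 * cosh (\<tau> (tail G e) - \<tau> (head G e))) powr (- \<alpha> * w $ coord (Inr e))) =
        (\<Prod>k\<in>UNIV. (2 * cosh (tension \<tau> (k, True))) powr (- \<alpha> * w $ k))"
      unfolding prod_coord by (simp add: tension_coord)
    also have "\<dots> = (\<Prod>k\<in>UNIV. exp (- (\<alpha> / 2 * w $ k * softplus (tension \<tau> (k, True)) +
        \<alpha> / 2 * w $ k * softplus (tension \<tau> (k, False)))))"
    proof (intro prod.cong refl)
      fix k
      have "2 * cosh (tension \<tau> (k, True)) > 0" using cosh_real_pos by simp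
      then have "(2 * cosh (tension \<tau> (k, True))) powr (- \<alpha> * w $ k) =
          exp (- \<alpha> * w $ k * ln (2 * cosh (tension \<tau> (k, True))))"
        by (simp add: powr_def)
      then show "(2 * cosh (tension \<tau> (k, True))) powr (- \<alpha> * w $ k) =
          exp (- (\<alpha> / 2 * w $ k * softplus (tension \<tau> (k, True)) +
            \<alpha> / 2 * w $ k * softplus (tension \<tau> (k, False))))"
        by (simp add: ln_2_cosh tension_False field_simps)
    qed
    also have "\<dots> = exp (- (\<Sum>a\<in>UNIV. \<alpha> / 2 * w $ fst a * softplus (tension \<tau> a)))"
      by (simp add: sum_UNIV_arcs exp_sum flip: sum_negf)
    finally show ?thesis
      by (simp add: arc_kernel_def spread_def exp_of_real[symmetric])
  qed
  then show ?thesis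
    unfolding zono_integral_def arc_integral_def of_real_mult integral_complex_of_real[symmetric]
    by simp
qed

lemma spread_pos:
  assumes "\<alpha> > 0" "\<And>k. w $ k > 0"
  shows "spread \<alpha> (cvec w) \<in> halfspaces (\<lambda>_. 0)"
  using assms by (intro halfspaces_pos) (simp add: spread_def)

text \<open>Some reciprocal Gamma factor vanishes, so its rate is \<open>- m\<close>; dividing by
  \<open>\<alpha> / 2\<close> produces the 2 in the asserted hyperplanes.\<close>

lemma pole_factor_spread_zero:
  assumes "\<alpha> > 0" "pole_factor (spread \<alpha> z) = 0"
  shows "\<exists>S m. S \<subseteq> verts G \<and> S \<noteq> {} \<and> Digraph_Component.connected (G \<restriction> S) \<and>
    energy_sum G (\<lambda>v. z $ coord (Inl v)) (\<lambda>e. z $ coord (Inr e)) S =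
      complex_of_real (- (2 * real m / \<alpha>))"
proof -
  obtain S s where i: "(S, s) \<in> rays" "rGamma (crate (ray (S, s)) (spread \<alpha> z)) = 0"
    using assms(2) finite_rays by (auto simp: pole_factor_def)
  then obtain m where m: "crate (ray (S, s)) (spread \<alpha> z) = - of_nat m"
    by (auto simp: rGamma_eq_zero_iff elim: nonpos_Ints_cases')
  let ?E = "energy_sum G (\<lambda>v. z $ coord (Inl v)) (\<lambda>e. z $ coord (Inr e)) S"
  have "complex_of_real (\<alpha> / 2) * ?E = - of_nat m"
    using m crate_ray_spread[OF i(1)] by simp
  then have "?E = complex_of_real (- (2 * real m / \<alpha>))"
    using assms(1) by (simp add: field_simps)
  then show ?thesis using rays_connected[OF i(1)] unfolding connected_sets_def by blast
qed

theorem zono_continuation_poles: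
  assumes \<alpha>: "\<alpha> > 0"
  shows "(\<exists>F. zono_continuation G \<alpha> coord F) \<and>
    (\<forall>F. zono_continuation G \<alpha> coord F \<longrightarrow>
       polar_set F \<subseteq>
         {z. \<exists>S m. S \<subseteq> verts G \<and> S \<noteq> {} \<and>
                Digraph_Component.connected (G \<restriction> S) \<and>
                energy_sum G (\<lambda>v. z $ coord (Inl v)) (\<lambda>e. z $ coord (Inr e)) S =
                  complex_of_real (- (2 * real m / \<alpha>))})"
proof -
  obtain \<Psi> where \<Psi>: "\<And>p. cdiff \<Psi> p" "\<And>p. p \<in> halfspaces (\<lambda>_. 0) \<Longrightarrow> \<Psi> p = regularized p"
    using regularized_entire by blast
  define \<Phi> where "\<Phi> = (\<lambda>z. complex_of_real (\<alpha> ^ card (verts G)) * \<Psi> (spread \<alpha> z))"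
  define H where "H = (\<lambda>z. pole_factor (spread \<alpha> z))"
  have \<Phi>: "cdiff \<Phi> z" for z
    unfolding \<Phi>_def by (intro cdiff_mult cdiff_const cdiff_compose_spread \<Psi>(1))
  have H: "cdiff H z" for z
    unfolding H_def by (rule cdiff_compose_spread[OF cdiff_pole_factor])
  have H_pos: "H (cvec w) \<noteq> 0" if "\<And>k. w $ k > 0" for w
    unfolding H_def by (rule pole_factor_nonzero[OF spread_pos[OF \<alpha> that]])
  have quotient: "complex_of_real (zono_integral G \<alpha> (\<lambda>v. w $ coord (Inl v)) (\<lambda>e. w $ coord (Inr e))) =
      \<Phi> (cvec w) / H (cvec w)" if w: "\<And>k. w $ k > 0" for w
    using \<Psi>(2)[OF spread_pos[OF \<alpha> w]] H_pos[OF w]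
    by (simp add: zono_integral_eq \<Phi>_def H_def regularized_def)
  have "zono_continuation G \<alpha> coord (\<lambda>z. \<Phi> z / H z)"
    unfolding zono_continuation_def
  proof (intro conjI allI impI)
    show "meromorphic_Cn (\<lambda>z. \<Phi> z / H z)"
      unfolding meromorphic_Cn_def
    proof
      fix p :: "complex ^ 'n"
      \<comment> \<open>If \<open>H\<close> vanished on a ball, the identity theorem would make it
        vanish at \<open>cvec 1\<close>, where all rates are positive.\<close>
      have "\<exists>z\<in>ball p 1. H z \<noteq> 0"
      proof (rule ccontr)
        assume *: "\<not> ?thesis"
        have "H (cvec 1) = 0"
          by (rule identity_Cn[OF open_UNIV convex_UNIV H open_ball, of p p 1]) (use * in auto)
        then show False using H_pos[of 1] by simp
      qed
      then have "\<exists>g h. holomorphic_Cn g (ball p 1) \<and> holomorphic_Cn h (ball p 1) \<and>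
          (\<exists>z\<in>ball p 1. h z \<noteq> 0) \<and> (\<forall>z\<in>ball p 1. h z \<noteq> 0 \<longrightarrow> \<Phi> z / H z = g z / h z)"
        by (intro exI[of _ \<Phi>] exI[of _ H]) (simp add: holomorphic_Cn_cdiff \<Phi> H)
      then show "\<exists>r>0. \<exists>g h. holomorphic_Cn g (ball p r) \<and> holomorphic_Cn h (ball p r) \<and>
          (\<exists>z\<in>ball p r. h z \<noteq> 0) \<and> (\<forall>z\<in>ball p r. h z \<noteq> 0 \<longrightarrow> \<Phi> z / H z = g z / h z)"
        by (intro exI[of _ "1 :: real"] conjI zero_less_one)
    qed
    fix w :: "real ^ 'n" assume "\<forall>k. w $ k > 0"
    then show "\<Phi> (\<chi> k. complex_of_real (w $ k)) / H (\<chi> k. complex_of_real (w $ k)) =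
        complex_of_real (zono_integral G \<alpha> (\<lambda>v. w $ coord (Inl v)) (\<lambda>e. w $ coord (Inr e)))"
      using quotient[of w] by (simp add: cvec_def)
  qed
  moreover have "polar_set F \<subseteq> {z. H z = 0}" if F: "zono_continuation G \<alpha> coord F" for F
  proof (rule polar_set_subset_zeros[OF _ \<Phi> H])
    show "meromorphic_Cn F" using F by (simp add: zono_continuation_def)
    fix w :: "real ^ 'n" assume w: "\<And>k. w $ k > 0"
    then show "H (cvec w) \<noteq> 0 \<and> F (cvec w) = \<Phi> (cvec w) / H (cvec w)"
      using F H_pos[OF w] quotient[OF w] by (simp add: zono_continuation_def cvec_def)
  qed
  ultimately show ?thesis
    using pole_factor_spread_zero[OF \<alpha>] unfolding H_def by blast
qed

end

theorem mainTheorem12: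
  fixes G :: "('v, 'e) pre_digraph"
    and \<alpha> :: real
    and coord :: "'v + 'e \<Rightarrow> 'n::finite"
  assumes "fin_digraph G"
    and "loopfree_digraph G"
    and "Digraph_Component.connected G"
    and "\<alpha> > 0"
    and "bij_betw coord (verts G <+> arcs G) UNIV"
  shows "(\<exists>F. zono_continuation G \<alpha> coord F) \<and>
    (\<forall>F. zono_continuation G \<alpha> coord F \<longrightarrow>
       polar_set F \<subseteq>
         {z. \<exists>S m. S \<subseteq> verts G \<and> S \<noteq> {} \<and>
                Digraph_Component.connected (G \<restriction> S) \<and>
                energy_sum G (\<lambda>v. z $ coord (Inl v)) (\<lambda>e. z $ coord (Inr e)) S =
                  complex_of_real (- (2 * real m / \<alpha>))})"
proof -
  have "verts G \<noteq> {}"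
    using assms(3) by (simp add: Digraph_Component.connected_def strongly_connected_def)
  then interpret labelled_graph G coord
    using assms by (intro labelled_graph.intro)
  show ?thesis by (rule zono_continuation_poles[OF assms(4)])
qed

end
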